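(* Let $W$ be a tetrahedral erasure channel that is either (i) $\mathrm{TEC}(p,q,r,s,t)$ with $pqrst>0$, or (ii) the TEC simulating a pair of binary erasure channels, namely $\mathrm{TEC}\bigl((1-\delta)(1-\varepsilon),\,(1-\delta)\varepsilon,\,0,\,\delta(1-\varepsilon),\,\delta\varepsilon\bigr)$ with $\delta,\varepsilon\in(0,1)$. Then the $2\times 2$ kernel $\begin{bmatrix}1&0\\ \omega&1\end{bmatrix}$ over $\mathbb F_4$ (with $\omega^2+\omega+1=0$) induces on $W$ a scaling exponent less than $3.451$: there exist $\mu<3.451$ and a constant $C>0$ such that for all $n\ge 0$, $$\mathbb P\bigl\{H(W_n)<\exp(-e^{n^{1/3}})\bigr\}\ \ge\ 1-H(W)-C\,2^{-n/\mu}.$$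
   Context: A tetrahedral erasure channel $\mathrm{TEC}(p,q,r,s,t)$ (with $p,q,r,s,t\ge0$, $p+q+r+s+t=1$) has uniformly distributed input $(x_1,x_2)\in\mathbb F_2^2$ and outputs: $(x_1,x_1+x_2,x_2)$ w.p. $p$; $(x_1,?,?)$ w.p. $q$; $(?,x_1+x_2,?)$ w.p. $r$; $(?,?,x_2)$ w.p. $s$; $(?,?,?)$ w.p. $t$. Its entropy is $H=\frac{q+r+s}{2}+t$. The kernel $\begin{bmatrix}1&0\\ \omega&1\end{bmatrix}$ over $\mathbb F_4\cong\mathbb F_2^2$ synthesizes from $W=\mathrm{TEC}(p,q,r,s,t)$ two channels: the serial child $W^{s}=\mathrm{TEC}(p^2,\ ps+sq+qp,\ pq+qr+rp,\ pr+rs+sp,\ 1-\text{(sum of the other four)})$ and the parallel child $W^{p}=\mathrm{TEC}(1-\text{(sum of the other four)},\ ts+sq+qt,\ tq+qr+rt,\ tr+rs+st,\ t^2)$. The channel process is $W_0=W$ and, for $n\ge1$, $W_n$ is $W_{n-1}^{s}$ or $W_{n-1}^{p}$ with probability $1/2$ each, independently. *)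

theory Defs
  imports Complex_Main
begin

text \<open>A tetrahedral erasure channel TEC(p,q,r,s,t) is represented by its parameter tuple.\<close>
type_synonym tec = "real \<times> real \<times> real \<times> real \<times> real"

definition is_tec :: "tec \<Rightarrow> bool" where
  "is_tec W = (case W of (p,q,r,s,t) \<Rightarrow>
     p \<ge> 0 \<and> q \<ge> 0 \<and> r \<ge> 0 \<and> s \<ge> 0 \<and> t \<ge> 0 \<and> p + q + r + s + t = 1)"

definition tec_entropy :: "tec \<Rightarrow> real" where
  "tec_entropy W = (case W of (p,q,r,s,t) \<Rightarrow> (q + r + s) / 2 + t)"

text \<open>Serial child under the kernel [[1,0],[omega,1]] over F4.\<close>
definition tec_serial :: "tec \<Rightarrow> tec" where
  "tec_serial W = (case W of (p,q,r,s,t) \<Rightarrow>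
     (let p' = p^2; q' = p*s + s*q + q*p; r' = p*q + q*r + r*p; s' = p*r + r*s + s*p
      in (p', q', r', s', 1 - (p' + q' + r' + s'))))"

definition tec_parallel :: "tec \<Rightarrow> tec" where
  "tec_parallel W = (case W of (p,q,r,s,t) \<Rightarrow>
     (let q' = t*s + s*q + q*t; r' = t*q + q*r + r*t; s' = t*r + r*s + s*t; t' = t^2
      in (1 - (q' + r' + s' + t'), q', r', s', t')))"

definition tec_process :: "tec \<Rightarrow> bool list \<Rightarrow> tec" where
  "tec_process W bs = foldl (\<lambda>w b. if b then tec_serial w else tec_parallel w) W bs"

definition process_prob :: "tec \<Rightarrow> nat \<Rightarrow> (tec \<Rightarrow> bool) \<Rightarrow> real" where
  "process_prob W n P = real (card {bs :: bool list. length bs = n \<and> P (tec_process W bs)}) / 2 ^ n"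

end

theory Submission
  imports Defs "HOL-Real_Asymp.Real_Asymp"
begin

text \<open>
  Let \<open>h\<close> be the entropy of a channel and \<open>u = q + r + s\<close>. The entropies of the children are those of the
  binary erasure channel, pushed further apart by \<open>u\<^sup>2/4 - \<sigma>/2 \<ge> u\<^sup>2/12\<close> with \<open>\<sigma> = qr + rs + sq\<close>, so a
  large \<open>u\<close> accelerates polarization; and if \<open>u\<close> is small compared with \<open>h (1 - h)\<close>, this ratio grows.
  Both effects are captured by the potential \<open>(h (1 - h)) powr (4/5) * u powr (-4/25)\<close>, whose mean
  shrinks at every step by the factor \<open>0.818 < 2 powr (-1/3.451)\<close>, uniformly in \<open>h\<close>, \<open>u\<close> and \<open>\<sigma>\<close>. With a
  correction that is only logarithmically small near \<open>h = 0\<close> and \<open>h = 1\<close>, the contraction bounds the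
  probability of every intermediate entropy value, and the martingale property of the entropy turns this
  into the lower bound for the probability of a tiny entropy.
\<close>

section \<open>Contraction of the potential\<close>

text \<open>Weighted AM-GM for \<open>5 * c\<close>, \<open>25 * P * x / 16\<close> and
  \<open>25 * R * z / 4\<close> with weights 1/5, 16/25 and 4/25. The hypothesis
  \<open>weight\<close> is the 25th power of the condition that the constants contribute a factor at
  least 1, so each instance is a check on rational numbers.\<close>

lemma weighted_am_gm:
  fixes x z c P R :: real
  assumes pos: "x > 0" "z > 0" "c > 0" "P > 0" "R > 0"
    and weight: "1 \<le> (5 * c) ^ 5 * (25 * P / 16) ^ 16 * (25 * R / 4) ^ 4"
  shows "x powr (16/25) * z powr (4/25) \<le> c + P * x + R * z"
proof -
  define S where "S = c + P * x + R * z"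
  have S: "S > 0" using pos by (simp add: S_def add_pos_pos)
  have ln_le: "ln v - ln S \<le> v / S - 1" if "v > 0" for v
    using ln_le_minus_one[of "v / S"] that S by (simp add: ln_div)
  have ln_weight: "ln (u ^ 5 * v ^ 16 * w ^ 4) = 5 * ln u + 16 * ln v + 4 * ln w"
    if "u > 0" "v > 0" "w > 0" for u v w :: real
    using that by (simp add: ln_mult_pos ln_realpow)
  have "0 \<le> ln ((5 * c) ^ 5 * (25 * P / 16) ^ 16 * (25 * R / 4) ^ 4)"
    using weight by (rule ln_ge_zero)
  also have "\<dots> = 5 * ln (5 * c) + 16 * ln (25 * P / 16) + 4 * ln (25 * R / 4)"
    using pos by (intro ln_weight) auto
  finally have w: "0 \<le> 5 * ln (5 * c) + 16 * ln (25 * P / 16) + 4 * ln (25 * R / 4)" .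
  have 1: "ln (5 * c) - ln S \<le> 5 * c / S - 1" using ln_le[of "5 * c"] pos by simp
  have 2: "ln (25 * P / 16) + ln x - ln S \<le> 25 * P * x / 16 / S - 1"
    using ln_le[of "25 * P / 16 * x"] ln_mult_pos[of "25 * P / 16" x] pos by simp
  have 3: "ln (25 * R / 4) + ln z - ln S \<le> 25 * R * z / 4 / S - 1"
    using ln_le[of "25 * R / 4 * z"] ln_mult_pos[of "25 * R / 4" z] pos by simp
  have "c / S + P * x / S + R * z / S = 1"
    using S by (simp add: S_def flip: add_divide_distrib)
  then have "16/25 * ln x + 4/25 * ln z \<le> ln S"
    using w 1 2 3 by simp
  then have "exp (16/25 * ln x + 4/25 * ln z) \<le> S"
    using S by (simp add: ln_ge_iff[symmetric])
  then show ?thesis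
    using pos by (simp add: powr_def exp_add S_def)
qed

text \<open>Here \<tau> stands for \<open>m * h\<close>. Any \<open>q\<close> above
  \<open>(3 - \<tau>\<^sup>2) / (3 - 2 * \<tau>)\<close> is allowed, so that this rational function
  can later be replaced by a parabola; the resulting bound is affine in \<open>k\<close>.\<close>

lemma chord_ratio_le:
  fixes k \<tau> :: real
  assumes k: "1/3 \<le> k" "k \<le> 1" and \<tau>: "0 \<le> \<tau>" "\<tau> < 1"
    and q: "3 - \<tau>\<^sup>2 \<le> (3 - 2 * \<tau>) * q"
  shows "(1 - k * \<tau>\<^sup>2) / (1 - (1 + k) / 2 * \<tau>) \<le> (3 - 3 * k) / 2 * q + (3 * k - 1) / 2 * (1 + \<tau>)"
    and "(1 - k * \<tau>\<^sup>2) / (1 - (1 + k) / 2 * \<tau>) \<le> 1 + \<tau>"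
    and "0 < 1 - (1 + k) / 2 * \<tau>" and "0 < 1 - k * \<tau>\<^sup>2"
proof -
  have "(1 + k) / 2 * \<tau> \<le> 1 * \<tau>" using k \<tau> by (intro mult_right_mono) auto
  then show den: "0 < 1 - (1 + k) / 2 * \<tau>" using \<tau> by simp
  have "k * \<tau>\<^sup>2 \<le> 1 * \<tau>\<^sup>2" using k by (intro mult_right_mono) auto
  moreover have "\<tau>\<^sup>2 < 1" using \<tau> by (simp add: power_less_one_iff abs_square_less_1)
  ultimately show "0 < 1 - k * \<tau>\<^sup>2" by simp
  have "(1 + \<tau>) * (1 - (1 + k) / 2 * \<tau>) - (1 - k * \<tau>\<^sup>2) = (1 - k) / 2 * (\<tau> * (1 - \<tau>))"
    by (simp add: field_simps power2_eq_square)
  moreover have "0 \<le> (1 - k) / 2 * (\<tau> * (1 - \<tau>))" using k \<tau> by simp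
  ultimately show "(1 - k * \<tau>\<^sup>2) / (1 - (1 + k) / 2 * \<tau>) \<le> 1 + \<tau>"
    using den by (simp add: pos_divide_le_eq)
  define Y where "Y = (3 - \<tau>\<^sup>2) / (3 - 2 * \<tau>)"
  have d3: "3 - 2 * \<tau> > 0" using \<tau> by simp
  have Y: "Y * (3 - 2 * \<tau>) = 3 - \<tau>\<^sup>2" using d3 by (simp add: Y_def)
  have "(1 + \<tau>) * (3 - 2 * \<tau>) - (3 - \<tau>\<^sup>2) = \<tau> * (1 - \<tau>)"
    by (simp add: field_simps power2_eq_square)
  moreover have "0 \<le> \<tau> * (1 - \<tau>)" using \<tau> by simp
  ultimately have Y_le: "Y \<le> 1 + \<tau>"
    using d3 by (simp add: Y_def pos_divide_le_eq)
  have Y_q: "Y \<le> q" using q d3 by (simp add: Y_def pos_divide_le_eq mult.commute)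
  \<comment> \<open>The ratio is a convex function of \<open>k\<close>, equal to \<open>Y\<close> at \<open>k = 1/3\<close> and to \<open>1 + \<tau>\<close> at \<open>k = 1\<close>.\<close>
  have "((3 - 3 * k) / 2 * Y + (3 * k - 1) / 2 * (1 + \<tau>)) * (1 - (1 + k) / 2 * \<tau>) - (1 - k * \<tau>\<^sup>2)
      = (3 - 3 * k) / 2 * ((3 * k - 1) / 2) * (\<tau> / 3) * (1 + \<tau> - Y)"
    using Y by algebra
  moreover have "0 \<le> (3 - 3 * k) / 2 * ((3 * k - 1) / 2) * (\<tau> / 3) * (1 + \<tau> - Y)"
    using k \<tau> Y_le by (intro mult_nonneg_nonneg) auto
  ultimately have "(1 - k * \<tau>\<^sup>2) / (1 - (1 + k) / 2 * \<tau>) \<le> (3 - 3 * k) / 2 * Y + (3 * k - 1) / 2 * (1 + \<tau>)"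
    using den by (simp add: pos_divide_le_eq)
  also have "\<dots> \<le> (3 - 3 * k) / 2 * q + (3 * k - 1) / 2 * (1 + \<tau>)"
    using k Y_q by (intro add_right_mono mult_left_mono) auto
  finally show "(1 - k * \<tau>\<^sup>2) / (1 - (1 + k) / 2 * \<tau>) \<le> (3 - 3 * k) / 2 * q + (3 * k - 1) / 2 * (1 + \<tau>)" .
qed

text \<open>The right-hand factor touches \<open>(3 - \<tau>\<^sup>2) / (3 - 2 * \<tau>)\<close> where \<open>3 - 2 * \<tau> = 1 / e\<close> and agrees with it at \<open>\<tau> = 1\<close>.\<close>
lemma tangent_parabola:
  fixes e \<tau> :: real
  assumes "\<tau> \<le> 1"
  shows "3 - \<tau>\<^sup>2 \<le> (3 - 2 * \<tau>) * (3/2 - 3 * e + 9/2 * e\<^sup>2 + (1/2 + 3 * e - 15/2 * e\<^sup>2) * \<tau> + 3 * e\<^sup>2 * \<tau>\<^sup>2)"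
proof -
  have "(3 - 2 * \<tau>) * (3/2 - 3 * e + 9/2 * e\<^sup>2 + (1/2 + 3 * e - 15/2 * e\<^sup>2) * \<tau> + 3 * e\<^sup>2 * \<tau>\<^sup>2) - (3 - \<tau>\<^sup>2)
      = 3/2 * ((3 - 2 * \<tau>) * e - 1)\<^sup>2 * (1 - \<tau>)"
    by algebra
  moreover have "0 \<le> 3/2 * ((3 - 2 * \<tau>) * e - 1)\<^sup>2 * (1 - \<tau>)" using assms by simp
  ultimately show ?thesis by linarith
qed

text \<open>
  For a channel with entropy \<open>h = 1 - g\<close>, edge weight \<open>u = q + r + s\<close> and \<open>\<sigma> = qr + rs + sq\<close>, put
  \<open>m = u / (2hg)\<close> and \<open>k = 1 - 2\<sigma> / u\<^sup>2\<close>, so that \<open>1/3 \<le> k \<le> 1\<close>. Then \<open>xfac k m h g\<close> is the factor by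
  which the serial step multiplies \<open>h * (1 - h)\<close>, and \<open>xfac / zfac\<close> the factor by which it multiplies \<open>u\<close>;
  swapping \<open>h\<close> and \<open>g\<close> gives the parallel step. Hence \<open>growth\<close> is the factor for the potential
  \<open>(h * (1 - h)) powr (4/5) * u powr - (4/25)\<close>.
\<close>
definition bfac :: "real \<Rightarrow> real \<Rightarrow> real \<Rightarrow> real \<Rightarrow> real" where
  "bfac k m h g = 1 + g + k * m\<^sup>2 * h * g\<^sup>2"

definition xfac :: "real \<Rightarrow> real \<Rightarrow> real \<Rightarrow> real \<Rightarrow> real" where
  "xfac k m h g = (1 - k * (m * h)\<^sup>2) * g * bfac k m h g"

definition zfac :: "real \<Rightarrow> real \<Rightarrow> real \<Rightarrow> real \<Rightarrow> real" where
  "zfac k m h g = bfac k m h g * ((1 - k * (m * h)\<^sup>2) / (1 - (1 + k) / 2 * (m * h))) / 2"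

definition growth :: "real \<Rightarrow> real \<Rightarrow> real \<Rightarrow> real \<Rightarrow> real" where
  "growth k m h g = xfac k m h g powr (16/25) * zfac k m h g powr (4/25)"

text \<open>Only the term \<open>(k * m\<^sup>2)\<^sup>2 * h ^ 3 * g ^ 3\<close>, which enters
  \<open>xfac\<close> negatively, is dropped. What remains is affine in \<open>k\<close> and
  quadratic in \<open>m\<close>.\<close>

lemma xfac_le:
  assumes "h > 0" "g > 0" "h + g = 1"
  shows "xfac k m h g \<le> g * (1 + g) - k * m\<^sup>2 * (h * g) * (4 * h - 2 * h\<^sup>2 - 1)"
proof -
  have g: "g = 1 - h" using assms by simp
  have "g * (1 + g) - k * m\<^sup>2 * (h * g) * (4 * h - 2 * h\<^sup>2 - 1) - xfac k m h g = (k * m\<^sup>2)\<^sup>2 * h ^ 3 * g ^ 3"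
    unfolding xfac_def bfac_def g by algebra
  moreover have "0 \<le> (k * m\<^sup>2)\<^sup>2 * h ^ 3 * g ^ 3" using assms by simp
  ultimately show ?thesis by linarith
qed

text \<open>The part \<open>1 + g\<close> of \<open>bfac\<close> gets the chord bound. The other
  part already carries a factor \<open>k * m\<^sup>2\<close>, so it gets the bound \<open>b\<close>,
  which is to be free of \<open>k\<close> and \<open>m\<close>; otherwise the degrees in
  \<open>k\<close> and \<open>m\<close> would rise.\<close>

lemma zfac_le:
  assumes k: "1/3 \<le> k" "k \<le> 1" and pos: "h > 0" "g > 0" "m > 0" "m * h < 1"
    and q: "3 - (m * h)\<^sup>2 \<le> (3 - 2 * (m * h)) * q"
    and b: "1 + m * h \<le> b"
  shows "zfac k m h g \<le> (1 + g) / 2 * ((3 - 3 * k) / 2 * q + (3 * k - 1) / 2 * (1 + m * h)) + k * m\<^sup>2 * h * g\<^sup>2 * b / 2"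
proof -
  have mh: "0 \<le> m * h" using pos by simp
  note Y = chord_ratio_le[OF k mh pos(4) q]
  have "zfac k m h g = (1 + g) / 2 * ((1 - k * (m * h)\<^sup>2) / (1 - (1 + k) / 2 * (m * h)))
     + k * m\<^sup>2 * h * g\<^sup>2 / 2 * ((1 - k * (m * h)\<^sup>2) / (1 - (1 + k) / 2 * (m * h)))"
    (is "_ = _ * ?Y + _ * ?Y")
  proof -
    have "(1 + g + v) * Y / 2 = (1 + g) / 2 * Y + v / 2 * Y" for v Y by (simp add: field_simps)
    then show ?thesis unfolding zfac_def bfac_def .
  qed
  also have "\<dots> \<le> (1 + g) / 2 * ((3 - 3 * k) / 2 * q + (3 * k - 1) / 2 * (1 + m * h)) + k * m\<^sup>2 * h * g\<^sup>2 / 2 * b"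
    using pos k Y(1) Y(2) b by (intro add_mono mult_left_mono) auto
  finally show ?thesis by simp
qed

lemma xfac_zfac_pos:
  assumes k: "1/3 \<le> k" "k \<le> 1" and pos: "h > 0" "g > 0" "m > 0" "m * h < 1"
  shows "xfac k m h g > 0" "zfac k m h g > 0"
proof -
  have mh: "0 \<le> m * h" using pos by simp
  have "3 - (m * h)\<^sup>2 \<le> (3 - 2 * (m * h)) * ((3 - (m * h)\<^sup>2) / (3 - 2 * (m * h)))" using pos by simp
  note Y = chord_ratio_le[OF k mh pos(4) this]
  have "0 < bfac k m h g" unfolding bfac_def using pos k by (intro add_pos_nonneg) auto
  then show "xfac k m h g > 0" "zfac k m h g > 0"
    unfolding xfac_def zfac_def using Y(3,4) pos by auto
qed

text \<open>
  After the arithmetic-geometric mean inequality, the growth factors are bounded by a polynomial that is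
  quadratic in \<open>m\<close> and affine in \<open>k\<close>; its coefficients are \<open>quad0\<close>, \<open>quad1\<close> and \<open>- quad2\<close>. So it is
  enough to control the discriminants at \<open>k = 1/3\<close> and \<open>k = 1\<close>, which are polynomials in \<open>h\<close> alone.
\<close>
definition quad0 :: "real \<Rightarrow> real \<Rightarrow> real \<Rightarrow> real \<Rightarrow> real \<Rightarrow> real \<Rightarrow> real \<Rightarrow> real" where
  "quad0 P\<^sub>1 R\<^sub>1 P\<^sub>2 R\<^sub>2 a b h =
     P\<^sub>1 * (1 - h) * (2 - h) + P\<^sub>2 * h * (1 + h) + R\<^sub>1 * (2 - h) * a / 2 + R\<^sub>2 * (1 + h) * b / 2"

definition quad1 :: "real \<Rightarrow> real \<Rightarrow> real \<Rightarrow> real \<Rightarrow> real \<Rightarrow> real" where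
  "quad1 R\<^sub>1 R\<^sub>2 a b h = R\<^sub>1 * (2 - h) * h * a / 2 + R\<^sub>2 * (1 + h) * (1 - h) * b / 2"

definition quad2 :: "real \<Rightarrow> real \<Rightarrow> real \<Rightarrow> real \<Rightarrow> real \<Rightarrow> real \<Rightarrow> real \<Rightarrow> real \<Rightarrow> real" where
  "quad2 k P\<^sub>1 R\<^sub>1 P\<^sub>2 R\<^sub>2 a b h =
     k * P\<^sub>1 * h * (1 - h) * (4 * h - 2 * h\<^sup>2 - 1) + k * P\<^sub>2 * h * (1 - h) * (1 - 2 * h\<^sup>2)
     - R\<^sub>1 * ((2 - h) * h\<^sup>2 * a + k * h * (1 - h)) / 2 - R\<^sub>2 * ((1 + h) * (1 - h)\<^sup>2 * b / 2 + k * (1 - h) * h\<^sup>2)"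

lemma quadratic_nonneg:
  fixes A B C m :: real
  assumes "C > 0" "B\<^sup>2 \<le> 4 * C * A"
  shows "0 \<le> A - B * m + C * m\<^sup>2"
proof -
  have "4 * C * (A - B * m + C * m\<^sup>2) = (2 * C * m - B)\<^sup>2 + (4 * C * A - B\<^sup>2)"
    by algebra
  then have "0 \<le> 4 * C * (A - B * m + C * m\<^sup>2)" using assms by simp
  then show ?thesis using assms by (simp add: zero_le_mult_iff)
qed

text \<open>The parameters \<open>a\<close> and \<open>b\<close> fix the points of tangency in
  \<open>tangent_parabola\<close> for the serial and the parallel step. At \<open>k = 1/3\<close>
  the arguments of \<open>quad0\<close>, \<open>quad1\<close>, \<open>quad2\<close> are the
  coefficients of these parabolas; at \<open>k = 1\<close> they are those of
  \<open>1 + m * h\<close> and \<open>1 + m * g\<close>, namely 1, 1, 0.\<close>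

lemma growth_sum_le_of_quadratics:
  fixes h g k m c\<^sub>1 P\<^sub>1 R\<^sub>1 c\<^sub>2 P\<^sub>2 R\<^sub>2 a b \<Lambda> :: real
  assumes k: "1/3 \<le> k" "k \<le> 1" and hg: "h > 0" "g > 0" "h + g = 1" and m: "m > 0" "m * h < 1" "m * g < 1"
    and pos: "c\<^sub>1 > 0" "P\<^sub>1 > 0" "R\<^sub>1 > 0" "c\<^sub>2 > 0" "P\<^sub>2 > 0" "R\<^sub>2 > 0"
    and weight: "1 \<le> (5 * c\<^sub>1) ^ 5 * (25 * P\<^sub>1 / 16) ^ 16 * (25 * R\<^sub>1 / 4) ^ 4"
      "1 \<le> (5 * c\<^sub>2) ^ 5 * (25 * P\<^sub>2 / 16) ^ 16 * (25 * R\<^sub>2 / 4) ^ 4"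
    and C0: "0 < quad2 (1/3) P\<^sub>1 R\<^sub>1 P\<^sub>2 R\<^sub>2 (3 * a\<^sup>2) (3 * b\<^sup>2) h"
    and D0: "(quad1 R\<^sub>1 R\<^sub>2 (1/2 + 3 * a - 15/2 * a\<^sup>2) (1/2 + 3 * b - 15/2 * b\<^sup>2) h)\<^sup>2
       \<le> 4 * quad2 (1/3) P\<^sub>1 R\<^sub>1 P\<^sub>2 R\<^sub>2 (3 * a\<^sup>2) (3 * b\<^sup>2) h
           * (\<Lambda> - c\<^sub>1 - c\<^sub>2 - quad0 P\<^sub>1 R\<^sub>1 P\<^sub>2 R\<^sub>2 (3/2 - 3 * a + 9/2 * a\<^sup>2) (3/2 - 3 * b + 9/2 * b\<^sup>2) h)"
    and C1: "0 < quad2 1 P\<^sub>1 R\<^sub>1 P\<^sub>2 R\<^sub>2 0 0 h"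
    and D1: "(quad1 R\<^sub>1 R\<^sub>2 1 1 h)\<^sup>2
       \<le> 4 * quad2 1 P\<^sub>1 R\<^sub>1 P\<^sub>2 R\<^sub>2 0 0 h * (\<Lambda> - c\<^sub>1 - c\<^sub>2 - quad0 P\<^sub>1 R\<^sub>1 P\<^sub>2 R\<^sub>2 1 1 h)"
  shows "growth k m h g + growth k m g h \<le> \<Lambda>"
proof -
  have g: "g = 1 - h" using hg by simp
  have gh: "g + h = 1" using hg by simp
  define q where "q e \<tau> = 3/2 - 3 * e + 9/2 * e\<^sup>2 + (1/2 + 3 * e - 15/2 * e\<^sup>2) * \<tau> + 3 * e\<^sup>2 * \<tau>\<^sup>2" for e \<tau> :: real
  have q: "3 - \<tau>\<^sup>2 \<le> (3 - 2 * \<tau>) * q e \<tau>" if "\<tau> < 1" for e \<tau>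
    unfolding q_def using tangent_parabola[of \<tau> e] that by simp
  \<comment> \<open>The bound \<open>1 / g\<close> cancels one factor \<open>g\<close> in the
    correction term of \<open>zfac\<close> and is at most 2 for \<open>h \<le> 1/2\<close>.\<close>
  have "(1 + m * h) * g \<le> 1"
  proof -
    have "(1 + m * h) * g = g + h * (m * g)" by (simp add: algebra_simps)
    also have "\<dots> \<le> g + h * 1" using m hg by (intro add_left_mono mult_left_mono) auto
    finally show ?thesis using hg by simp
  qed
  then have b1: "1 + m * h \<le> 1 / g" using hg by (simp add: pos_le_divide_eq)
  have gg: "k * m\<^sup>2 * h * g\<^sup>2 * (1 / g) / 2 = k * m\<^sup>2 * h * g / 2" using hg by (simp add: power2_eq_square)
  have z1: "zfac k m h g \<le> (1 + g) / 2 * ((3 - 3 * k) / 2 * q a (m * h) + (3 * k - 1) / 2 * (1 + m * h)) + k * m\<^sup>2 * h * g / 2"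
    using zfac_le[OF k hg(1,2) m(1,2) q[OF m(2)] b1] unfolding gg .
  \<comment> \<open>Here \<open>b\<close> is 2: for \<open>h \<le> 1/2\<close> this is no worse than
    the mirrored bound \<open>1 / h\<close>.\<close>
  have z2: "zfac k m g h \<le> (1 + h) / 2 * ((3 - 3 * k) / 2 * q b (m * g) + (3 * k - 1) / 2 * (1 + m * g)) + k * m\<^sup>2 * g * h\<^sup>2 * 2 / 2"
    using zfac_le[OF k hg(2,1) m(1,3) q[OF m(3)], of 2] m by simp
  have x1: "xfac k m h g \<le> g * (1 + g) - k * m\<^sup>2 * (h * g) * (4 * h - 2 * h\<^sup>2 - 1)"
    by (rule xfac_le[OF hg])
  have x2: "xfac k m g h \<le> h * (1 + h) - k * m\<^sup>2 * (g * h) * (4 * g - 2 * g\<^sup>2 - 1)"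
    by (rule xfac_le[OF hg(2,1) gh])
  have "growth k m h g \<le> c\<^sub>1 + P\<^sub>1 * xfac k m h g + R\<^sub>1 * zfac k m h g"
    unfolding growth_def
    by (rule weighted_am_gm[OF xfac_zfac_pos[OF k hg(1,2) m(1,2)] pos(1-3) weight(1)])
  moreover have "growth k m g h \<le> c\<^sub>2 + P\<^sub>2 * xfac k m g h + R\<^sub>2 * zfac k m g h"
    unfolding growth_def
    by (rule weighted_am_gm[OF xfac_zfac_pos[OF k hg(2,1) m(1,3)] pos(4-6) weight(2)])
  moreover note mult_left_mono[OF x1, of P\<^sub>1] mult_left_mono[OF x2, of P\<^sub>2]
    mult_left_mono[OF z1, of R\<^sub>1] mult_left_mono[OF z2, of R\<^sub>2]
  ultimately have sum: "growth k m h g + growth k m g h \<le> c\<^sub>1 + c\<^sub>2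
      + P\<^sub>1 * (g * (1 + g) - k * m\<^sup>2 * (h * g) * (4 * h - 2 * h\<^sup>2 - 1))
      + P\<^sub>2 * (h * (1 + h) - k * m\<^sup>2 * (g * h) * (4 * g - 2 * g\<^sup>2 - 1))
      + R\<^sub>1 * ((1 + g) / 2 * ((3 - 3 * k) / 2 * q a (m * h) + (3 * k - 1) / 2 * (1 + m * h)) + k * m\<^sup>2 * h * g / 2)
      + R\<^sub>2 * ((1 + h) / 2 * ((3 - 3 * k) / 2 * q b (m * g) + (3 * k - 1) / 2 * (1 + m * g)) + k * m\<^sup>2 * g * h\<^sup>2 * 2 / 2)"
    (is "_ \<le> ?S") using pos by linarith
  define N0 where "N0 = \<Lambda> - c\<^sub>1 - c\<^sub>2 - quad0 P\<^sub>1 R\<^sub>1 P\<^sub>2 R\<^sub>2 (3/2 - 3 * a + 9/2 * a\<^sup>2) (3/2 - 3 * b + 9/2 * b\<^sup>2) h"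
  define N1 where "N1 = \<Lambda> - c\<^sub>1 - c\<^sub>2 - quad0 P\<^sub>1 R\<^sub>1 P\<^sub>2 R\<^sub>2 1 1 h"
  define B0 where "B0 = quad1 R\<^sub>1 R\<^sub>2 (1/2 + 3 * a - 15/2 * a\<^sup>2) (1/2 + 3 * b - 15/2 * b\<^sup>2) h"
  define B1 where "B1 = quad1 R\<^sub>1 R\<^sub>2 1 1 h"
  define Q0 where "Q0 = quad2 (1/3) P\<^sub>1 R\<^sub>1 P\<^sub>2 R\<^sub>2 (3 * a\<^sup>2) (3 * b\<^sup>2) h"
  define Q1 where "Q1 = quad2 1 P\<^sub>1 R\<^sub>1 P\<^sub>2 R\<^sub>2 0 0 h"
  \<comment> \<open>Everything is affine in \<open>k\<close>, hence the convex combination of its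
    values at \<open>k = 1/3\<close> and \<open>k = 1\<close>.\<close>
  have "\<Lambda> - ?S = (3 - 3 * k) / 2 * (N0 - B0 * m + Q0 * m\<^sup>2) + (3 * k - 1) / 2 * (N1 - B1 * m + Q1 * m\<^sup>2)"
    unfolding N0_def N1_def B0_def B1_def Q0_def Q1_def quad0_def quad1_def quad2_def q_def
    unfolding g by (simp add: field_simps power2_eq_square)
  moreover have "0 \<le> (3 - 3 * k) / 2 * (N0 - B0 * m + Q0 * m\<^sup>2)"
    using k quadratic_nonneg[OF C0 D0, of m] by (simp add: N0_def B0_def Q0_def)
  moreover have "0 \<le> (3 * k - 1) / 2 * (N1 - B1 * m + Q1 * m\<^sup>2)"
    using k quadratic_nonneg[OF C1 D1, of m] by (simp add: N1_def B1_def Q1_def)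
  ultimately show ?thesis using sum by linarith
qed

section \<open>Bernstein certificates on subintervals of [0, 1/2]\<close>

text \<open>A homogeneous form of degree one less than the length of the list; entry
  \<open>i\<close> belongs to \<open>x ^ i\<close>. With \<open>x = h - l\<close> and
  \<open>y = r - h\<close> it is a polynomial on \<open>[l, r]\<close> in the Bernstein basis, with
  binomials and powers of \<open>r - l\<close> absorbed into the entries.\<close>

fun bform :: "real list \<Rightarrow> real \<Rightarrow> real \<Rightarrow> real" where
  "bform [] x y = 0"
| "bform (c # cs) x y = c * y ^ length cs + x * bform cs x y"

lemma bform_nonneg: "(\<forall>c\<in>set cs. 0 \<le> c) \<Longrightarrow> 0 \<le> x \<Longrightarrow> 0 \<le> y \<Longrightarrow> 0 \<le> bform cs x y"
  by (induction cs) auto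

lemma bform_expand:
  "bform [c0, c1, c2, c3, c4] x y = c0 * y ^ 4 + x * (c1 * y ^ 3 + x * (c2 * y\<^sup>2 + x * (c3 * y + x * c4)))"
  "bform [c0, c1, c2, c3, c4, c5, c6] x y =
    c0 * y ^ 6 + x * (c1 * y ^ 5 + x * (c2 * y ^ 4 + x * (c3 * y ^ 3 + x * (c4 * y\<^sup>2 + x * (c5 * y + x * c6)))))"
  by (simp_all add: eval_nat_numeral)

text \<open>Nonnegative Bernstein coefficients certify the sign of a polynomial on the whole
  interval. The summand 1/1000 supplies the strict positivity of the leading coefficients
  \<open>quad2\<close>; these have degree 4 in \<open>h\<close>, the discriminants degree 6.\<close>

lemma growth_sum_le_of_bform:
  fixes h g k m c\<^sub>1 P\<^sub>1 R\<^sub>1 c\<^sub>2 P\<^sub>2 R\<^sub>2 a b \<Lambda> l r :: real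
  assumes k: "1/3 \<le> k" "k \<le> 1" and hg: "h > 0" "g > 0" "h + g = 1" and m: "m > 0" "m * h < 1" "m * g < 1"
    and h: "l \<le> h" "h \<le> r"
    and pos: "c\<^sub>1 > 0" "P\<^sub>1 > 0" "R\<^sub>1 > 0" "c\<^sub>2 > 0" "P\<^sub>2 > 0" "R\<^sub>2 > 0"
    and weight: "1 \<le> (5 * c\<^sub>1) ^ 5 * (25 * P\<^sub>1 / 16) ^ 16 * (25 * R\<^sub>1 / 4) ^ 4"
      "1 \<le> (5 * c\<^sub>2) ^ 5 * (25 * P\<^sub>2 / 16) ^ 16 * (25 * R\<^sub>2 / 4) ^ 4"
    and nonneg: "\<forall>c\<in>set (C0 @ C1 @ D0 @ D1). 0 \<le> c"
    and C0: "quad2 (1/3) P\<^sub>1 R\<^sub>1 P\<^sub>2 R\<^sub>2 (3 * a\<^sup>2) (3 * b\<^sup>2) h = 1/1000 + bform C0 (h - l) (r - h)"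
    and C1: "quad2 1 P\<^sub>1 R\<^sub>1 P\<^sub>2 R\<^sub>2 0 0 h = 1/1000 + bform C1 (h - l) (r - h)"
    and D0: "4 * quad2 (1/3) P\<^sub>1 R\<^sub>1 P\<^sub>2 R\<^sub>2 (3 * a\<^sup>2) (3 * b\<^sup>2) h
           * (\<Lambda> - c\<^sub>1 - c\<^sub>2 - quad0 P\<^sub>1 R\<^sub>1 P\<^sub>2 R\<^sub>2 (3/2 - 3 * a + 9/2 * a\<^sup>2) (3/2 - 3 * b + 9/2 * b\<^sup>2) h)
         - (quad1 R\<^sub>1 R\<^sub>2 (1/2 + 3 * a - 15/2 * a\<^sup>2) (1/2 + 3 * b - 15/2 * b\<^sup>2) h)\<^sup>2 = bform D0 (h - l) (r - h)"
    and D1: "4 * quad2 1 P\<^sub>1 R\<^sub>1 P\<^sub>2 R\<^sub>2 0 0 h * (\<Lambda> - c\<^sub>1 - c\<^sub>2 - quad0 P\<^sub>1 R\<^sub>1 P\<^sub>2 R\<^sub>2 1 1 h)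
         - (quad1 R\<^sub>1 R\<^sub>2 1 1 h)\<^sup>2 = bform D1 (h - l) (r - h)"
  shows "growth k m h g + growth k m g h \<le> \<Lambda>"
proof (rule growth_sum_le_of_quadratics[OF k hg m pos weight])
  have "0 \<le> bform C0 (h - l) (r - h)" "0 \<le> bform C1 (h - l) (r - h)" "0 \<le> bform D0 (h - l) (r - h)" "0 \<le> bform D1 (h - l) (r - h)"
    using nonneg h by (simp_all add: bform_nonneg)
  then show "0 < quad2 (1/3) P\<^sub>1 R\<^sub>1 P\<^sub>2 R\<^sub>2 (3 * a\<^sup>2) (3 * b\<^sup>2) h" "0 < quad2 1 P\<^sub>1 R\<^sub>1 P\<^sub>2 R\<^sub>2 0 0 h"
    "(quad1 R\<^sub>1 R\<^sub>2 (1/2 + 3 * a - 15/2 * a\<^sup>2) (1/2 + 3 * b - 15/2 * b\<^sup>2) h)\<^sup>2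
       \<le> 4 * quad2 (1/3) P\<^sub>1 R\<^sub>1 P\<^sub>2 R\<^sub>2 (3 * a\<^sup>2) (3 * b\<^sup>2) h
           * (\<Lambda> - c\<^sub>1 - c\<^sub>2 - quad0 P\<^sub>1 R\<^sub>1 P\<^sub>2 R\<^sub>2 (3/2 - 3 * a + 9/2 * a\<^sup>2) (3/2 - 3 * b + 9/2 * b\<^sup>2) h)"
    "(quad1 R\<^sub>1 R\<^sub>2 1 1 h)\<^sup>2
       \<le> 4 * quad2 1 P\<^sub>1 R\<^sub>1 P\<^sub>2 R\<^sub>2 0 0 h * (\<Lambda> - c\<^sub>1 - c\<^sub>2 - quad0 P\<^sub>1 R\<^sub>1 P\<^sub>2 R\<^sub>2 1 1 h)"
    using C0 C1 D0 D1 by linarith+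
qed

text \<open>
  On each interval \<open>c\<^sub>i, P\<^sub>i, R\<^sub>i\<close> come from the tangent planes of \<open>x powr (16/25) * z powr (4/25)\<close> near the
  numerically worst \<open>m\<close>, and the lists are the exact (scaled) Bernstein coefficients on that interval.
\<close>
lemma growth_sum_le_1:
  assumes "1/3 \<le> k" "k \<le> 1" "h > 0" "g > 0" "h + g = 1" "m > 0" "m * h < 1" "m * g < 1"
    and "1/100 \<le> h" "h \<le> 2/25"
  shows "growth k m h g + growth k m g h \<le> 409/250"
  by (rule growth_sum_le_of_bform[OF assms, where c\<^sub>1="291/1000" and P\<^sub>1="13/25" and R\<^sub>1="23/100"
      and c\<^sub>2="17/500" and P\<^sub>2="17/10" and R\<^sub>2="3/100" and a="17/50" and b="9/50"
      and ?C0.0="[10084577/214375, 63805243/51450, 4471480067/1286250, 2180819674/643125, 713343272/643125]"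
      and ?C1.0="[24355136/60025, 286905427/60025, 724299274/60025, 679889928/60025, 218407456/60025]"
      and ?D0.0="[531753531553439/2941225000000, 82285757841886289/4411837500000, 248557774504429711/2941225000000, 160052754300807077/1102959375000, 5143426425738201/45956640625, 954578182420109/27573984375, 80917428899271/45956640625]"
      and ?D1.0="[494754410783/73530625, 7274645599484/73530625, 5528444518711/14706125, 9094844683384/14706125, 7165459386304/14706125, 12453419248064/73530625, 1235115221952/73530625]"])
    ((simp add: power_divide; fail)+,
      unfold quad0_def quad1_def quad2_def bform_expand, (algebra | (simp add: field_simps eval_nat_numeral; fail))+)

lemma growth_sum_le_2:
  assumes "1/3 \<le> k" "k \<le> 1" "h > 0" "g > 0" "h + g = 1" "m > 0" "m * h < 1" "m * g < 1"
    and "2/25 \<le> h" "h \<le> 1/8"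
  shows "growth k m h g + growth k m g h \<le> 409/250"
  by (rule growth_sum_le_of_bform[OF assms, where c\<^sub>1="267/1000" and P\<^sub>1="27/50" and R\<^sub>1="11/50"
      and c\<^sub>2="13/250" and P\<^sub>2="69/50" and R\<^sub>2="1/25" and a="7/20" and b="12/25"
      and ?C0.0="[22001486336/12301875, 126555827936/12301875, 660018548/32805, 2597484979/157464, 767893075/157464]"
      and ?C1.0="[2536070656/164025, 466671232/6561, 263901200/2187, 588475000/6561, 162025000/6561]"
      and ?D0.0="[1763816592441344/207594140625, 6122982466333696/69198046875, 20870264786069173/69198046875, 31023401770131863/66430125000, 9888042555925669/28343520000, 63451818367997/566870400, 1150149884831/136048896]"
      and ?D1.0="[20141918519296/110716875, 1841918480384/1476225, 1004358109696/295245, 831781326080/177147, 202151565500/59049, 72126875000/59049, 27890312500/177147]"])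
    ((simp add: power_divide; fail)+,
      unfold quad0_def quad1_def quad2_def bform_expand, (algebra | (simp add: field_simps eval_nat_numeral; fail))+)

lemma growth_sum_le_3:
  assumes "1/3 \<le> k" "k \<le> 1" "h > 0" "g > 0" "h + g = 1" "m > 0" "m * h < 1" "m * g < 1"
    and "1/8 \<le> h" "h \<le> 33/200"
  shows "growth k m h g + growth k m g h \<le> 409/250"
  by (rule growth_sum_le_of_bform[OF assms, where c\<^sub>1="267/1000" and P\<^sub>1="27/50" and R\<^sub>1="11/50"
      and c\<^sub>2="63/1000" and P\<^sub>2="123/100" and R\<^sub>2="1/20" and a="9/25" and b="13/25"
      and ?C0.0="[28878125/8192, 110326307/6144, 3341339303/102400, 97763105323/3840000, 37179644589/5120000]"
      and ?C1.0="[272753125/8192, 295963125/2048, 956861775/4096, 341526869/2048, 9087807517/204800]"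
      and ?D0.0="[4567429375/524288, 392301083891/3932160, 339571043744419/983040000, 1086175705612787/2048000000, 237193224799246451/614400000000, 35762870181498551/307200000000, 1297593341035167/204800000000]"
      and ?D1.0="[236545078125/524288, 784746559375/262144, 4186565909875/524288, 1434671921865/131072, 21219531613839/2621440, 19877302370199/6553600, 144584090451949/327680000]"])
    ((simp add: power_divide; fail)+,
      unfold quad0_def quad1_def quad2_def bform_expand, (algebra | (simp add: field_simps eval_nat_numeral; fail))+)

lemma growth_sum_le_4:
  assumes "1/3 \<le> k" "k \<le> 1" "h > 0" "g > 0" "h + g = 1" "m > 0" "m * h < 1" "m * g < 1"
    and "33/200 \<le> h" "h \<le> 21/100"
  shows "growth k m h g + growth k m g h \<le> 409/250"
  by (rule growth_sum_le_of_bform[OF assms, where c\<^sub>1="321/1250" and P\<^sub>1="111/200" and R\<^sub>1="207/1000"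
      and c\<^sub>2="17/250" and P\<^sub>2="283/250" and R\<^sub>2="63/1000" and a="37/100" and b="53/100"
      and ?C0.0="[30622105637/13668750, 77834148263/6834375, 2504877457/121500, 109375631587/6834375, 31007056469/6834375]"
      and ?C1.0="[80492524027/3280500, 86233950673/820125, 45919756376/273375, 97248991948/820125, 25603309588/820125]"
      and ?D0.0="[34307676686668277279/5314410000000000, 64059680768587270657/885735000000000, 149686597007018286719/590490000000000, 267554695764759479327/664301250000000, 69611285241553616629/221433750000000, 171785358847126007/1537734375000, 4142976435531990119/332150625000000]"
      and ?D1.0="[7744939933955713/22143375000, 2145438719471003/922640625, 766714630693799/123018750, 4772892811008056/553584375, 1195491097781986/184528125, 255710859934192/102515625, 1053347263232936/2767921875]"])
    ((simp add: power_divide; fail)+,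
      unfold quad0_def quad1_def quad2_def bform_expand, (algebra | (simp add: field_simps eval_nat_numeral; fail))+)

lemma growth_sum_le_5:
  assumes "1/3 \<le> k" "k \<le> 1" "h > 0" "g > 0" "h + g = 1" "m > 0" "m * h < 1" "m * g < 1"
    and "21/100 \<le> h" "h \<le> 11/40"
  shows "growth k m h g + growth k m g h \<le> 409/250"
  by (rule growth_sum_le_of_bform[OF assms, where c\<^sub>1="239/1000" and P\<^sub>1="29/50" and R\<^sub>1="19/100"
      and c\<^sub>2="17/200" and P\<^sub>2="103/100" and R\<^sub>2="7/100" and a="19/50" and b="13/25"
      and ?C0.0="[12218852682/17850625, 183598736441/53551875, 130928694683/21420750, 39955938803/8568300, 740293741/571220]"
      and ?C1.0="[4508964728/714025, 3891352136/142805, 1247933912/28561, 881275870/28561, 462691525/57122]"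
      and ?D0.0="[5722897749960559/7541889062500, 66491053708468456/5656416796875, 2062014555228844009/45251334375000, 678754614330208873/9050266875000, 280492602923438431/4826809000000, 28054383009037133/1448042700000, 324770504213919/193072360000]"
      and ?D1.0="[130685551323488/3016755625, 189389703986944/603351125, 21415329117128/24134045, 6093734342848/4826809, 4601730426810/4826809, 1734926355920/4826809, 499570211475/9653618]"])
    ((simp add: power_divide; fail)+,
      unfold quad0_def quad1_def quad2_def bform_expand, (algebra | (simp add: field_simps eval_nat_numeral; fail))+)

lemma growth_sum_le_6:
  assumes "1/3 \<le> k" "k \<le> 1" "h > 0" "g > 0" "h + g = 1" "m > 0" "m * h < 1" "m * g < 1"
    and "11/40 \<le> h" "h \<le> 37/100"
  shows "growth k m h g + growth k m g h \<le> 409/250"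
  by (rule growth_sum_le_of_bform[OF assms, where c\<^sub>1="28/125" and P\<^sub>1="3/5" and R\<^sub>1="9/50"
      and c\<^sub>2="107/1000" and P\<^sub>2="9/10" and R\<^sub>2="9/100" and a="2/5" and b="51/100"
      and ?C0.0="[1398850143/10425680, 36814848281/52128400, 166127498797/130321000, 312945324243/325802500, 42165557269/162901250]"
      and ?C1.0="[195661625/130321, 844944650/130321, 1347586620/130321, 940228472/130321, 242315840/130321]"
      and ?D0.0="[4976426836321911/30109363840000, 184297417465739703/75273409600000, 7094653426222187031/752734096000000, 7186796457117068967/470458810000000, 27023098184194300707/2352294050000000, 535838832061248249/147018378125000, 334955321171699031/1176147025000000]"
      and ?D1.0="[379702468125/47045881, 2793150186750/47045881, 7907098848975/47045881, 11121690069720/47045881, 8183730620664/47045881, 2949935770368/47045881, 393397263216/47045881]"])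
    ((simp add: power_divide; fail)+,
      unfold quad0_def quad1_def quad2_def bform_expand, (algebra | (simp add: field_simps eval_nat_numeral; fail))+)

lemma growth_sum_le_7:
  assumes "1/3 \<le> k" "k \<le> 1" "h > 0" "g > 0" "h + g = 1" "m > 0" "m * h < 1" "m * g < 1"
    and "37/100 \<le> h" "h \<le> 1/2"
  shows "growth k m h g + growth k m g h \<le> 409/250"
  by (rule growth_sum_le_of_bform[OF assms, where c\<^sub>1="91/500" and P\<^sub>1="67/100" and R\<^sub>1="3/20"
      and c\<^sub>2="3/20" and P\<^sub>2="77/100" and R\<^sub>2="11/100" and a="11/25" and b="12/25"
      and ?C0.0="[1725112279/35701250, 8337899429/35701250, 826220371/2142075, 7456190/28561, 5272700/85683]"
      and ?C1.0="[336443717/714025, 57126593/28561, 88708600/28561, 59607500/28561, 14650000/28561]"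
      and ?D0.0="[910697335557111/30167556250000, 8890438838893411/15083778125000, 213022843668241933/90502668750000, 563394128033313/150837781250, 48025825016213/18100533750, 93333980588/120670225, 799214557/14480427]"
      and ?D1.0="[4140962593263/3016755625, 1396531878054/120670225, 841274586419/24134045, 241501864280/4826809, 175903061000/4826809, 61104200000/4826809, 7603750000/4826809]"])
    ((simp add: power_divide; fail)+,
      unfold quad0_def quad1_def quad2_def bform_expand, (algebra | (simp add: field_simps eval_nat_numeral; fail))+)

text \<open>The discriminant criterion degenerates as \<open>h\<close> tends to 0: for
  \<open>k = 1\<close> the leading coefficient \<open>quad2\<close> vanishes there. Crude bounds
  suffice instead, since \<open>m\<close> stays below 100/99 and \<open>xfac k m g h\<close> is of
  order \<open>h\<close>.\<close>

lemma growth_sum_le_0: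
  assumes k: "1/3 \<le> k" "k \<le> 1" and hg: "h > 0" "g > 0" "h + g = 1" and m: "m > 0" "m * h < 1" "m * g < 1"
    and h: "h \<le> 1/100"
  shows "growth k m h g + growth k m g h \<le> 409/250"
proof -
  have g: "g = 1 - h" using hg by simp
  have mg2: "(m * g)\<^sup>2 \<le> 1" using m hg by (simp add: power_le_one)
  have kmg: "k * (m * g)\<^sup>2 \<le> 1" using mult_mono[OF k(2) mg2] k by simp
  have b1: "bfac k m h g \<le> 2"
  proof -
    have "bfac k m h g = 1 + g + h * (k * (m * g)\<^sup>2)" unfolding bfac_def by (simp add: algebra_simps power2_eq_square)
    also have "\<dots> \<le> 1 + g + h * 1" using kmg hg by (intro add_left_mono mult_left_mono) auto
    finally show ?thesis using hg by simp
  qed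
  have m2: "m \<le> 100/99"
  proof -
    have "m * (99/100) \<le> m * g" using m g h by (intro mult_left_mono) auto
    then show ?thesis using m by linarith
  qed
  have mh: "m * h \<le> 1/99"
    using mult_mono[OF m2 h] m hg by simp
  have b2: "bfac k m g h \<le> 1.011"
  proof -
    have "k * m\<^sup>2 * g * h\<^sup>2 = k * (m * g) * (m * h) * h" by (simp add: power2_eq_square)
    also have "\<dots> \<le> 1 * 1 * (1/99) * (1/100)"
      using k m hg mh h by (intro mult_mono) auto
    finally show ?thesis unfolding bfac_def using h by simp
  qed
  have bpos: "0 < bfac k m h g" "0 < bfac k m g h"
    unfolding bfac_def using k m hg by (auto intro!: add_pos_nonneg)
  have Y: "(1 - k * \<tau>\<^sup>2) / (1 - (1 + k) / 2 * \<tau>) \<le> 1 + \<tau>" "0 < 1 - (1 + k) / 2 * \<tau>" "0 < 1 - k * \<tau>\<^sup>2"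
    if "0 \<le> \<tau>" "\<tau> < 1" for \<tau>
    using chord_ratio_le[OF k that, of "(3 - \<tau>\<^sup>2) / (3 - 2 * \<tau>)"] that by auto
  have x1: "xfac k m h g \<le> 2"
  proof -
    have "xfac k m h g = ((1 - k * (m * h)\<^sup>2) * g) * bfac k m h g" by (simp add: xfac_def)
    also have "\<dots> \<le> (1 * 1) * 2" using b1 hg k Y(3)[of "m * h"] m bpos by (intro mult_mono) auto
    finally show ?thesis by simp
  qed
  have z1: "zfac k m h g \<le> 1.011"
  proof -
    have "zfac k m h g \<le> 2 * (1 + m * h) / 2" unfolding zfac_def
      using b1 Y[of "m * h"] m hg by (intro divide_right_mono mult_mono) auto
    then show ?thesis using mh by simp
  qed
  have x2: "xfac k m g h \<le> 1.011 / 100"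
  proof -
    have "xfac k m g h = ((1 - k * (m * g)\<^sup>2) * h) * bfac k m g h" by (simp add: xfac_def)
    also have "\<dots> \<le> (1 * (1/100)) * 1.011" using b2 hg h k Y(3)[of "m * g"] m bpos by (intro mult_mono) auto
    finally show ?thesis by simp
  qed
  have z2: "zfac k m g h \<le> 1.011"
  proof -
    have "zfac k m g h \<le> 1.011 * 2 / 2" unfolding zfac_def
      using b2 Y[of "m * g"] m hg by (intro divide_right_mono mult_mono) auto
    then show ?thesis by simp
  qed
  \<comment> \<open>Approximately the tangent plane of the geometric mean at \<open>x = 2\<close>,
    \<open>z = 1\<close>.\<close>
  have "growth k m h g \<le> 0.311 + 0.5 * xfac k m h g + 0.25 * zfac k m h g"
    unfolding growth_def using xfac_zfac_pos[OF k hg(1,2) m(1,2)]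
    by (intro weighted_am_gm) (simp_all add: power_divide)
  also have "\<dots> \<le> 1.565" using x1 z1 by simp
  finally have G1: "growth k m h g \<le> 1.565" .
  \<comment> \<open>Approximately the tangent plane at \<open>x = 1/100\<close>,
    \<open>z = 1\<close>.\<close>
  have "growth k m g h \<le> 0.011 + 3.4 * xfac k m g h + 0.009 * zfac k m g h"
    unfolding growth_def using xfac_zfac_pos[OF k hg(2,1) m(1,3)]
    by (intro weighted_am_gm) (simp_all add: power_divide)
  also have "\<dots> \<le> 0.056" using x2 z2 by simp
  finally show ?thesis using G1 by simp
qed

lemma growth_sum_le_half:
  assumes "1/3 \<le> k" "k \<le> 1" "h > 0" "g > 0" "h + g = 1" "m > 0" "m * h < 1" "m * g < 1" "h \<le> g"
  shows "growth k m h g + growth k m g h \<le> 409/250"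
proof -
  have "h \<le> 1/2" using assms by simp
  then consider "h \<le> 1/100" | "1/100 \<le> h" "h \<le> 2/25" | "2/25 \<le> h" "h \<le> 1/8" | "1/8 \<le> h" "h \<le> 33/200"
    | "33/200 \<le> h" "h \<le> 21/100" | "21/100 \<le> h" "h \<le> 11/40" | "11/40 \<le> h" "h \<le> 37/100" | "37/100 \<le> h" "h \<le> 1/2"
    by linarith
  then show ?thesis
    by cases (rule growth_sum_le_0 growth_sum_le_1 growth_sum_le_2 growth_sum_le_3 growth_sum_le_4 growth_sum_le_5
        growth_sum_le_6 growth_sum_le_7; use assms in simp)+
qed

lemma growth_sum_le:
  assumes "1/3 \<le> k" "k \<le> 1" "h > 0" "g > 0" "h + g = 1" "m > 0" "m * h < 1" "m * g < 1"
  shows "growth k m h g + growth k m g h \<le> 409/250"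
proof (cases "h \<le> g")
  case True
  then show ?thesis using assms by (intro growth_sum_le_half)
next
  case False
  then have "growth k m g h + growth k m h g \<le> 409/250" using assms by (intro growth_sum_le_half) auto
  then show ?thesis by simp
qed

section \<open>Tetrahedral erasure channels\<close>

text \<open>For the serial child \<open>g'\<close> is one minus the entropy; with \<open>h\<close>
  and \<open>g\<close> swapped it is the entropy of the parallel child. If \<open>x\<close> and
  \<open>y\<close> are the factors for \<open>h * g\<close> and \<open>u\<close>, then
  \<open>zfac\<close> is \<open>x / y\<close>, and splitting 4/5 = 16/25 + 4/25 turns
  \<open>x powr (4/5) * y powr - (4/25)\<close> into \<open>growth\<close>.\<close>

lemma child_potential_eq:
  fixes h g u \<sigma> :: real
  assumes hg: "h > 0" "g > 0" "h + g = 1" and u: "u > 0" "u < 2 * h" "u < 2 * g"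
    and \<sigma>: "0 \<le> \<sigma>" "\<sigma> \<le> u\<^sup>2 / 3"
  defines "k \<equiv> 1 - 2 * \<sigma> / u\<^sup>2" and "m \<equiv> u / (2 * h * g)" and "g' \<equiv> g\<^sup>2 - u\<^sup>2 / 4 + \<sigma> / 2"
  shows "((1 - g') * g') powr (4/5) * ((2 * g - u) * u + \<sigma>) powr - (4/25)
     = growth k m h g * ((h * g) powr (4/5) * u powr - (4/25))"
proof -
  have k: "1/3 \<le> k" "k \<le> 1" using \<sigma> u by (simp_all add: k_def field_simps)
  have m: "m > 0" "m * h < 1" using hg u by (simp_all add: m_def field_simps)
  have ku: "k * u\<^sup>2 = u\<^sup>2 - 2 * \<sigma>" using u by (simp add: k_def field_simps)
  have mh: "m * h * (2 * g) = u" "m * (2 * h * g) = u" using hg by (simp_all add: m_def)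
  define x where "x = xfac k m h g"
  define y where "y = 2 * g * (1 - (1 + k) / 2 * (m * h))"
  have "3 - (m * h)\<^sup>2 \<le> (3 - 2 * (m * h)) * ((3 - (m * h)\<^sup>2) / (3 - 2 * (m * h)))" using m by simp
  note Y = chord_ratio_le[OF k _ m(2) this]
  have y: "y > 0" unfolding y_def using Y(3) m hg by simp
  have x: "x > 0" unfolding x_def by (rule xfac_zfac_pos[OF k hg(1,2) m])
  have z: "zfac k m h g = x / y"
    unfolding zfac_def x_def xfac_def y_def using hg by simp
  have g'1: "g' = g\<^sup>2 * (1 - k * (m * h)\<^sup>2)"
  proof -
    have "4 * (k * (m * h * g)\<^sup>2) = k * u\<^sup>2" unfolding mh(1)[symmetric] by (simp add: power2_eq_square)
    then show ?thesis unfolding g'_def ku by (simp add: algebra_simps power_mult_distrib)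
  qed
  have g'2: "1 - g' = h * bfac k m h g"
  proof -
    have g: "g = 1 - h" using hg by simp
    show ?thesis unfolding g'1 bfac_def g by algebra
  qed
  have xhg: "(1 - g') * g' = x * (h * g)"
    unfolding g'2 unfolding g'1 x_def xfac_def by (simp add: power2_eq_square)
  have yu: "(2 * g - u) * u + \<sigma> = y * u"
  proof -
    have "y = 2 * g - (1 + k) / 2 * u" unfolding y_def mh(1)[symmetric] by (simp add: algebra_simps)
    then have "y * u = (2 * g - (1 + k) / 2 * u) * u" by simp
    also have "\<dots> = 2 * g * u - u\<^sup>2 / 2 - k * u\<^sup>2 / 2" by (simp add: field_simps power2_eq_square)
    finally have "y * u = 2 * g * u - u\<^sup>2 / 2 - k * u\<^sup>2 / 2" .
    then show ?thesis unfolding ku by (simp add: field_simps power2_eq_square)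
  qed
  have "x powr (4/5) * y powr - (4/25) = growth k m h g"
  proof -
    have "growth k m h g = x powr (16/25) * (x powr (4/25) / y powr (4/25))"
      unfolding growth_def z using x y by (simp add: powr_divide x_def[symmetric])
    also have "\<dots> = x powr (16/25 + 4/25) * y powr - (4/25)"
      unfolding powr_add by (simp add: powr_minus_divide)
    finally show ?thesis by simp
  qed
  then show ?thesis
    unfolding xhg yu using x y hg u by (simp add: powr_mult)
qed

lemma potential_children_le:
  fixes h g u \<sigma> :: real
  assumes hg: "h > 0" "g > 0" "h + g = 1" and u: "u > 0" "u < 2 * h" "u < 2 * g"
    and \<sigma>: "0 \<le> \<sigma>" "\<sigma> \<le> u\<^sup>2 / 3"
  shows "((1 - (g\<^sup>2 - u\<^sup>2 / 4 + \<sigma> / 2)) * (g\<^sup>2 - u\<^sup>2 / 4 + \<sigma> / 2)) powr (4/5) * ((2 * g - u) * u + \<sigma>) powr - (4/25)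
      + ((1 - (h\<^sup>2 - u\<^sup>2 / 4 + \<sigma> / 2)) * (h\<^sup>2 - u\<^sup>2 / 4 + \<sigma> / 2)) powr (4/5) * ((2 * h - u) * u + \<sigma>) powr - (4/25)
    \<le> 409/250 * ((h * g) powr (4/5) * u powr - (4/25))"
proof -
  define k m where "k = 1 - 2 * \<sigma> / u\<^sup>2" and "m = u / (2 * h * g)"
  have km: "1/3 \<le> k" "k \<le> 1" "m > 0" "m * h < 1" "m * g < 1"
    using \<sigma> hg u by (simp_all add: k_def m_def field_simps)
  have m': "u / (2 * g * h) = m" by (simp add: m_def mult_ac)
  have gh: "g + h = 1" using hg by simp
  have "growth k m h g + growth k m g h \<le> 409/250"
    using km hg by (intro growth_sum_le)
  then have "(growth k m h g + growth k m g h) * ((h * g) powr (4/5) * u powr - (4/25))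
      \<le> 409/250 * ((h * g) powr (4/5) * u powr - (4/25))"
    by (intro mult_right_mono) auto
  then show ?thesis
    unfolding child_potential_eq[OF hg u \<sigma>] child_potential_eq[OF hg(2,1) gh u(1,3,2) \<sigma>] m'
    by (simp add: k_def m_def algebra_simps)
qed

text \<open>The probability that the output reveals exactly one of \<open>x1\<close>,
  \<open>x1 + x2\<close>, \<open>x2\<close>.\<close>

fun tec_edges :: "tec \<Rightarrow> real" where
  "tec_edges (p, q, r, s, t) = q + r + s"

text \<open>An invariant of the process that covers both families of the theorem. Only the sum of
  the edge weights is asked to be positive, because \<open>r = 0\<close> in the second
  family.\<close>

fun nondegenerate :: "tec \<Rightarrow> bool" where
  "nondegenerate (p, q, r, s, t) \<longleftrightarrow> is_tec (p, q, r, s, t) \<and> 0 < p \<and> 0 < t \<and> 0 < q + r + s"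

definition potential :: "tec \<Rightarrow> real" where
  "potential W = (tec_entropy W * (1 - tec_entropy W)) powr (4/5) * tec_edges W powr - (4/25)"

text \<open>With entropy \<open>h\<close> and edge weight \<open>u\<close>,
  \<open>2 * h = u + 2 * t\<close> and \<open>2 * (1 - h) = u + 2 * p\<close>.\<close>

lemma nondegenerate_bounds:
  assumes "nondegenerate W"
  shows "0 < tec_entropy W" "tec_entropy W < 1" "0 < tec_edges W"
    "tec_edges W < 2 * tec_entropy W" "tec_edges W < 2 * (1 - tec_entropy W)"
  using assms by (cases W; auto simp: is_tec_def tec_entropy_def field_simps)+

text \<open>Both children depend on the edge weights only through \<open>tec_edges\<close> and the symmetric function \<open>\<sigma>\<close>.\<close>
lemma tec_children:
  assumes "nondegenerate W"
  obtains \<sigma> where "0 \<le> \<sigma>" "\<sigma> \<le> (tec_edges W)\<^sup>2 / 3"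
    "tec_entropy (tec_serial W) = 1 - ((1 - tec_entropy W)\<^sup>2 - (tec_edges W)\<^sup>2 / 4 + \<sigma> / 2)"
    "tec_entropy (tec_parallel W) = (tec_entropy W)\<^sup>2 - (tec_edges W)\<^sup>2 / 4 + \<sigma> / 2"
    "tec_edges (tec_serial W) = (2 * (1 - tec_entropy W) - tec_edges W) * tec_edges W + \<sigma>"
    "tec_edges (tec_parallel W) = (2 * tec_entropy W - tec_edges W) * tec_edges W + \<sigma>"
proof -
  obtain p q r s t where W: "W = (p, q, r, s, t)" by (cases W)
  have t: "t = 1 - p - q - r - s" using assms by (simp add: W is_tec_def)
  have nn: "0 \<le> q" "0 \<le> r" "0 \<le> s" using assms by (simp_all add: W is_tec_def)
  show thesis
  proof (rule that[of "q * r + r * s + s * q"])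
    show "0 \<le> q * r + r * s + s * q" using nn by simp
    have "(q + r + s)\<^sup>2 / 3 = q * r + r * s + s * q + ((q - r)\<^sup>2 + (r - s)\<^sup>2 + (s - q)\<^sup>2) / 6"
      by (simp add: field_simps power2_eq_square)
    then show "q * r + r * s + s * q \<le> (tec_edges W)\<^sup>2 / 3" by (simp add: W)
  qed (simp_all add: W t tec_serial_def tec_parallel_def tec_entropy_def Let_def field_simps power2_eq_square)
qed

text \<open>The child weight defined as a complement expands into nonnegative terms including a
  positive square. One identity serves both children: \<open>x = p\<close>, \<open>y = t\<close> for
  the serial one, and the reverse for the parallel one.\<close>

lemma nondegenerate_children:
  assumes "nondegenerate W"
  shows "nondegenerate (tec_serial W)" "nondegenerate (tec_parallel W)"
proof -
  obtain p q r s t where W: "W = (p, q, r, s, t)" by (cases W)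
  have pos: "0 < p" "0 \<le> q" "0 \<le> r" "0 \<le> s" "0 < t" "0 < q + r + s" and t: "p + q + r + s + t = 1"
    using assms by (simp_all add: W is_tec_def)
  have T: "1 - (x\<^sup>2 + (x * s + s * q + q * x) + (x * q + q * r + r * x) + (x * r + r * s + s * x))
      = y\<^sup>2 + 2 * x * y + 2 * y * (q + r + s) + (q\<^sup>2 + r\<^sup>2 + s\<^sup>2 + q * r + r * s + s * q)"
    if "x + q + r + s + y = 1" for x y
  proof -
    have "y = 1 - x - q - r - s" using that by simp
    then show ?thesis by algebra
  qed
  have T0: "0 < 1 - (x\<^sup>2 + (x * s + s * q + q * x) + (x * q + q * r + r * x) + (x * r + r * s + s * x))"
    if "0 < x" "0 < y" "x + q + r + s + y = 1" for x y
    unfolding T[OF that(3)] using that pos by (intro add_pos_nonneg) auto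
  have E: "0 < (x * s + s * q + q * x) + (x * q + q * r + r * x) + (x * r + r * s + s * x)" if "0 < x" for x
  proof -
    have "0 < 2 * x * (q + r + s)" using that pos by simp
    moreover have "0 \<le> s * q + q * r + r * s" using pos by simp
    ultimately have "0 < 2 * x * (q + r + s) + (s * q + q * r + r * s)" by (rule add_pos_nonneg)
    then show ?thesis by (simp add: algebra_simps)
  qed
  have t': "t + q + r + s + p = 1" using t by simp
  show "nondegenerate (tec_serial W)"
    using T0[OF pos(1,5) t] E[OF pos(1)] pos
    by (simp add: W tec_serial_def Let_def is_tec_def)
  have "0 < 1 - ((t * s + s * q + q * t) + (t * q + q * r + r * t) + (t * r + r * s + s * t) + t\<^sup>2)"
    using T0[OF pos(5,1) t'] by linarith
  then show "nondegenerate (tec_parallel W)"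
    using E[OF pos(5)] pos
    by (simp add: W tec_parallel_def Let_def is_tec_def)
qed

lemma potential_step:
  assumes "nondegenerate W"
  shows "potential (tec_serial W) + potential (tec_parallel W) \<le> 409/250 * potential W"
proof -
  note b = nondegenerate_bounds[OF assms]
  obtain \<sigma> where \<sigma>: "0 \<le> \<sigma>" "\<sigma> \<le> (tec_edges W)\<^sup>2 / 3"
    "tec_entropy (tec_serial W) = 1 - ((1 - tec_entropy W)\<^sup>2 - (tec_edges W)\<^sup>2 / 4 + \<sigma> / 2)"
    "tec_entropy (tec_parallel W) = (tec_entropy W)\<^sup>2 - (tec_edges W)\<^sup>2 / 4 + \<sigma> / 2"
    "tec_edges (tec_serial W) = (2 * (1 - tec_entropy W) - tec_edges W) * tec_edges W + \<sigma>"
    "tec_edges (tec_parallel W) = (2 * tec_entropy W - tec_edges W) * tec_edges W + \<sigma>"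
    using tec_children[OF assms] by blast
  define X Y where "X = (1 - tec_entropy W)\<^sup>2 - (tec_edges W)\<^sup>2 / 4 + \<sigma> / 2"
    and "Y = (tec_entropy W)\<^sup>2 - (tec_edges W)\<^sup>2 / 4 + \<sigma> / 2"
  have "tec_entropy (tec_serial W) * (1 - tec_entropy (tec_serial W)) = (1 - X) * X"
    "tec_entropy (tec_parallel W) * (1 - tec_entropy (tec_parallel W)) = (1 - Y) * Y"
    unfolding \<sigma> X_def[symmetric] Y_def[symmetric] by simp_all
  then show ?thesis
    using potential_children_le[of "tec_entropy W" "1 - tec_entropy W" "tec_edges W" \<sigma>] b \<sigma>(1,2)
    unfolding potential_def \<sigma>(5,6) X_def[symmetric] Y_def[symmetric] by simp
qed

section \<open>Expectations along the process and the entropy martingale\<close>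

text \<open>The expectation of \<open>f\<close> at the \<open>n\<close>-th channel. It recurses on
  the first step, as \<open>foldl\<close> does, so inductions generalize over the starting
  channel.\<close>

fun tec_mean :: "nat \<Rightarrow> (tec \<Rightarrow> real) \<Rightarrow> tec \<Rightarrow> real" where
  "tec_mean 0 f W = f W"
| "tec_mean (Suc n) f W = (tec_mean n f (tec_serial W) + tec_mean n f (tec_parallel W)) / 2"

lemma process_prob_eq_mean: "process_prob W n P = tec_mean n (\<lambda>w. of_bool (P w)) W"
proof (induction n arbitrary: W)
  case 0
  have "{bs. bs = [] \<and> P (tec_process W bs)} = (if P W then {[]} else {})"
    by (auto simp: tec_process_def)
  then show ?case by (simp add: process_prob_def)
next
  case (Suc n)
  define A where "A V = {bs :: bool list. length bs = n \<and> P (tec_process V bs)}" for V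
  have fin: "finite (A V)" for V
    by (rule finite_subset[OF _ finite_lists_length_eq[of "UNIV :: bool set" n]]) (auto simp: A_def)
  have "{bs. length bs = Suc n \<and> P (tec_process W bs)}
      = (#) True ` A (tec_serial W) \<union> (#) False ` A (tec_parallel W)"
  proof (intro set_eqI iffI)
    fix bs assume "bs \<in> {bs. length bs = Suc n \<and> P (tec_process W bs)}"
    then show "bs \<in> (#) True ` A (tec_serial W) \<union> (#) False ` A (tec_parallel W)"
      by (cases bs) (auto simp: A_def tec_process_def split: if_splits)
  qed (auto simp: A_def tec_process_def)
  then have "card {bs. length bs = Suc n \<and> P (tec_process W bs)} = card (A (tec_serial W)) + card (A (tec_parallel W))"
    using fin by (simp, subst card_Un_disjoint) (auto simp: card_image)
  then have "process_prob W (Suc n) P = (process_prob (tec_serial W) n P + process_prob (tec_parallel W) n P) / 2"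
    by (simp add: process_prob_def A_def field_simps)
  then show ?case by (simp add: Suc.IH)
qed

lemma tec_mean_mono:
  assumes "\<And>w. nondegenerate w \<Longrightarrow> f w \<le> f' w" "nondegenerate W"
  shows "tec_mean n f W \<le> tec_mean n f' W"
  using assms(2)
proof (induction n arbitrary: W)
  case (Suc n)
  then show ?case
    using Suc.IH[OF nondegenerate_children(1)] Suc.IH[OF nondegenerate_children(2)] by (simp add: add_mono)
qed (simp add: assms(1))

lemma tec_mean_affine:
  "tec_mean n (\<lambda>w. c - f w - d * f' w) W = c - tec_mean n f W - d * tec_mean n f' W"
proof (induction n arbitrary: W)
  case (Suc n)
  show ?case unfolding tec_mean.simps Suc.IH by (simp add: field_simps)
qed simp

text \<open>Entropy is a martingale: the correction \<open>u^2 / 4 - \<sigma> / 2\<close> enters the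
  two children with opposite signs.\<close>

lemma tec_mean_entropy: "nondegenerate W \<Longrightarrow> tec_mean n tec_entropy W = tec_entropy W"
proof (induction n arbitrary: W)
  case (Suc n)
  obtain \<sigma> where "tec_entropy (tec_serial W) = 1 - ((1 - tec_entropy W)\<^sup>2 - (tec_edges W)\<^sup>2 / 4 + \<sigma> / 2)"
    "tec_entropy (tec_parallel W) = (tec_entropy W)\<^sup>2 - (tec_edges W)\<^sup>2 / 4 + \<sigma> / 2"
    using tec_children[OF Suc.prems] by blast
  then have "tec_entropy (tec_serial W) + tec_entropy (tec_parallel W) = 2 * tec_entropy W"
    by (simp add: power2_eq_square algebra_simps)
  then show ?case
    using Suc.IH[OF nondegenerate_children(1)[OF Suc.prems]] Suc.IH[OF nondegenerate_children(2)[OF Suc.prems]] by simp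
qed simp

lemma tec_mean_le_power:
  assumes "\<And>w. nondegenerate w \<Longrightarrow> f (tec_serial w) + f (tec_parallel w) \<le> 2 * c * f w"
    and "0 \<le> c" "nondegenerate W"
  shows "tec_mean n f W \<le> c ^ n * f W"
  using assms(3)
proof (induction n arbitrary: W)
  case (Suc n)
  have "tec_mean (Suc n) f W \<le> (c ^ n * f (tec_serial W) + c ^ n * f (tec_parallel W)) / 2"
    using Suc.IH[OF nondegenerate_children(1)] Suc.IH[OF nondegenerate_children(2)] Suc.prems by (simp add: add_mono)
  also have "\<dots> = c ^ n * (f (tec_serial W) + f (tec_parallel W)) / 2" by (simp add: algebra_simps)
  also have "\<dots> \<le> c ^ n * (2 * c * f W) / 2"
    using assms Suc.prems by (intro divide_right_mono mult_left_mono) auto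
  finally show ?case by (simp add: mult_ac)
qed simp

section \<open>Logarithmic weight and Lyapunov function\<close>

text \<open>At \<open>exp (- y)\<close> the value is \<open>1 / (1 + y)\<close>, so even a doubly
  exponentially small entropy \<open>exp (- exp (n powr (1/3)))\<close> has a weight whose
  reciprocal is subexponential in \<open>n\<close>.\<close>

definition log_weight :: "real \<Rightarrow> real" where
  "log_weight x = 1 / (1 - ln x)"

lemma ln_less_one:
  fixes x :: real
  assumes "0 < x" "x \<le> 1"
  shows "ln x < 1"
proof -
  have "ln x \<le> 0" using assms by (simp add: ln_le_zero_iff)
  then show ?thesis by simp
qed

lemma log_weight_mono: "0 < x \<Longrightarrow> x \<le> y \<Longrightarrow> y \<le> 1 \<Longrightarrow> log_weight x \<le> log_weight y"
  unfolding log_weight_def by (intro divide_left_mono mult_pos_pos) (auto simp: ln_less_one)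

lemma log_weight_bounds:
  assumes "0 < x" "x \<le> 1"
  shows "0 < log_weight x" "log_weight x \<le> 1"
proof -
  have "ln x \<le> 0" using assms by (simp add: ln_le_zero_iff)
  then show "0 < log_weight x" "log_weight x \<le> 1" unfolding log_weight_def by auto
qed

text \<open>With \<open>L = - ln x\<close>, doubling \<open>x\<close> lowers \<open>L\<close> by
  less than 1, while squaring doubles \<open>L\<close> and so nearly halves the weight. The sum is
  thus close to 3/2 of the old weight once \<open>L\<close> is large.\<close>

lemma log_weight_step:
  assumes "0 < x" "x \<le> exp (- 10)" "0 < a" "a \<le> 2 * x" "0 < b" "b \<le> x\<^sup>2"
  shows "log_weight a + log_weight b \<le> 409/250 * log_weight x"
proof -
  define L where "L = - ln x"
  have "ln x \<le> ln (exp (- 10))" using assms by (subst ln_le_cancel_iff) auto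
  then have L: "L \<ge> 10" by (simp add: L_def)
  have "exp (- 10) \<le> (1/2 :: real)"
    using exp_ge_add_one_self[of "10::real"] by (simp add: exp_minus field_simps)
  then have x2: "2 * x \<le> 1" using assms by simp
  have xx: "x\<^sup>2 \<le> 1" using x2 assms by (simp add: power_le_one)
  have "log_weight a \<le> log_weight (2 * x)" using assms x2 by (intro log_weight_mono)
  also have "\<dots> = 1 / (1 + L - ln 2)" using assms by (simp add: log_weight_def L_def ln_mult_pos algebra_simps)
  also have "\<dots> \<le> 1 / L" using ln_2_less_1 L by (intro divide_left_mono mult_pos_pos) auto
  finally have 1: "log_weight a \<le> 1 / L" .
  have "log_weight b \<le> log_weight (x\<^sup>2)" using assms xx by (intro log_weight_mono) auto
  also have "\<dots> = 1 / (1 + 2 * L)" using assms by (simp add: log_weight_def L_def ln_realpow)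
  finally have 2: "log_weight b \<le> 1 / (1 + 2 * L)" .
  \<comment> \<open>Both constants are sharp at \<open>L = 10\<close>; their sum is about 1.624,
    below 1.636.\<close>
  have "1 / L \<le> 11/10 / (1 + L)" using L by (simp add: field_simps)
  moreover have "1 / (1 + 2 * L) \<le> 11/21 / (1 + L)" using L by (simp add: field_simps)
  moreover have "11/10 / (1 + L) + 11/21 / (1 + L) \<le> 409/250 / (1 + L)"
    using L unfolding add_divide_distrib[symmetric] by (intro divide_right_mono) auto
  ultimately have "log_weight a + log_weight b \<le> 409/250 / (1 + L)" using 1 2 by linarith
  then show ?thesis by (simp add: log_weight_def L_def)
qed

definition tec_log_weight :: "tec \<Rightarrow> real" where
  "tec_log_weight W = min (log_weight (tec_entropy W)) (log_weight (1 - tec_entropy W))"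

text \<open>The one-step bounds of the binary erasure channel survive. The correction
  \<open>u^2 / 4 - \<sigma> / 2\<close> is nonnegative, which gives the squares, and at most
  \<open>h^2\<close> and \<open>(1 - h)^2\<close>, which gives the factors 2.\<close>

lemma tec_entropy_children:
  assumes "nondegenerate W"
  shows "tec_entropy (tec_serial W) \<le> 2 * tec_entropy W" "tec_entropy (tec_parallel W) \<le> (tec_entropy W)\<^sup>2"
    "1 - tec_entropy (tec_serial W) \<le> (1 - tec_entropy W)\<^sup>2" "1 - tec_entropy (tec_parallel W) \<le> 2 * (1 - tec_entropy W)"
proof -
  define h u where "h = tec_entropy W" and "u = tec_edges W"
  have b: "0 < u" "u < 2 * h" "u < 2 * (1 - h)"
    using nondegenerate_bounds[OF assms] by (simp_all add: h_def u_def)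
  obtain \<sigma> where \<sigma>: "0 \<le> \<sigma>" "\<sigma> \<le> u\<^sup>2 / 3"
    "tec_entropy (tec_serial W) = 1 - ((1 - h)\<^sup>2 - u\<^sup>2 / 4 + \<sigma> / 2)"
    "tec_entropy (tec_parallel W) = h\<^sup>2 - u\<^sup>2 / 4 + \<sigma> / 2"
    using tec_children[OF assms] unfolding h_def u_def by blast
  have 1: "u\<^sup>2 / 4 \<le> h\<^sup>2" using power_mono[of u "2 * h" 2] b by (simp add: power_mult_distrib)
  have 2: "u\<^sup>2 / 4 \<le> (1 - h)\<^sup>2" using power_mono[of u "2 * (1 - h)" 2] b unfolding power_mult_distrib by simp
  have 3: "(1 - h)\<^sup>2 = 1 - 2 * h + h\<^sup>2" by (simp add: power2_eq_square algebra_simps)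
  have 4: "u\<^sup>2 / 4 \<le> 1 - 2 * h + h\<^sup>2" using 2 unfolding 3 .
  have 5: "0 \<le> u\<^sup>2" by simp
  have aux: "b / 4 \<le> a \<Longrightarrow> 1 - (1 - 2 * h + a - b / 4 + \<sigma> / 2) \<le> 2 * h"
    "b / 4 \<le> 1 - 2 * h + a \<Longrightarrow> 1 - (a - b / 4 + \<sigma> / 2) \<le> 2 * (1 - h)" if "0 \<le> \<sigma>" for a b
    using that by (simp_all add: algebra_simps)
  show "tec_entropy (tec_serial W) \<le> 2 * tec_entropy W" "1 - tec_entropy (tec_parallel W) \<le> 2 * (1 - tec_entropy W)"
    unfolding \<sigma>(3,4) h_def[symmetric] 3 using aux(1)[OF \<sigma>(1) 1] aux(2)[OF \<sigma>(1) 4] .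
  show "tec_entropy (tec_parallel W) \<le> (tec_entropy W)\<^sup>2" "1 - tec_entropy (tec_serial W) \<le> (1 - tec_entropy W)\<^sup>2"
    unfolding \<sigma>(3,4) h_def[symmetric] using \<sigma>(2) 5 by linarith+
qed

lemma tec_log_weight_bounds:
  assumes "nondegenerate W"
  shows "0 < tec_log_weight W" "tec_log_weight W \<le> 1"
  using nondegenerate_bounds[OF assms] log_weight_bounds[of "tec_entropy W"] log_weight_bounds[of "1 - tec_entropy W"]
  by (auto simp: tec_log_weight_def)

lemma tec_log_weight_step:
  assumes "nondegenerate W" "tec_entropy W \<le> exp (- 10) \<or> 1 - tec_entropy W \<le> exp (- 10)"
  shows "tec_log_weight (tec_serial W) + tec_log_weight (tec_parallel W) \<le> 409/250 * tec_log_weight W"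
proof -
  define h where "h = tec_entropy W"
  define hs hp where "hs = tec_entropy (tec_serial W)" and "hp = tec_entropy (tec_parallel W)"
  have b: "0 < h" "h < 1" "0 < hs" "hs < 1" "0 < hp" "hp < 1"
    using nondegenerate_bounds assms(1) nondegenerate_children[OF assms(1)] by (auto simp: h_def hs_def hp_def)
  have c: "hs \<le> 2 * h" "hp \<le> h\<^sup>2" "1 - hs \<le> (1 - h)\<^sup>2" "1 - hp \<le> 2 * (1 - h)"
    using tec_entropy_children[OF assms(1)] by (auto simp: h_def hs_def hp_def)
  have small: "exp (- 10) \<le> (1/2 :: real)"
    using exp_ge_add_one_self[of "10::real"] by (simp add: exp_minus field_simps)
  have lw: "tec_log_weight W = min (log_weight h) (log_weight (1 - h))"
    "tec_log_weight (tec_serial W) = min (log_weight hs) (log_weight (1 - hs))"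
    "tec_log_weight (tec_parallel W) = min (log_weight hp) (log_weight (1 - hp))"
    by (simp_all add: tec_log_weight_def h_def hs_def hp_def)
  consider "h \<le> exp (- 10)" | "1 - h \<le> exp (- 10)" using assms(2) by (auto simp: h_def)
  then show ?thesis
  proof cases
    case 1
    have "log_weight h \<le> log_weight (1 - h)" using 1 small b by (intro log_weight_mono) auto
    moreover have "log_weight hs + log_weight hp \<le> 409/250 * log_weight h"
      using 1 b c by (intro log_weight_step) auto
    ultimately show ?thesis unfolding lw by linarith
  next
    case 2
    have "log_weight (1 - h) \<le> log_weight h" using 2 small b by (intro log_weight_mono) auto
    moreover have "log_weight (1 - hp) + log_weight (1 - hs) \<le> 409/250 * log_weight (1 - h)"
      using 2 b c by (intro log_weight_step) auto
    ultimately show ?thesis unfolding lw by linarith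
  qed
qed

lemma potential_nonneg: "0 \<le> potential W"
  by (simp add: potential_def)

lemma potential_ge:
  assumes "nondegenerate W" "exp (- 10) \<le> tec_entropy W" "exp (- 10) \<le> 1 - tec_entropy W"
  shows "exp (- 16) \<le> potential W"
proof -
  note b = nondegenerate_bounds[OF assms(1)]
  have "exp (- 10) * exp (- 10) \<le> tec_entropy W * (1 - tec_entropy W)"
    using assms b by (intro mult_mono) auto
  then have "exp (- 20) \<le> tec_entropy W * (1 - tec_entropy W)" by (simp flip: exp_add)
  then have "exp (- 20) powr (4/5) \<le> (tec_entropy W * (1 - tec_entropy W)) powr (4/5)"
    by (intro powr_mono2) auto
  moreover have "exp (- 20 :: real) powr (4/5) = exp (- 16)" by (simp add: powr_def)
  moreover have "1 \<le> tec_edges W powr - (4/25)"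
  proof -
    \<comment> \<open>The two bounds \<open>u < 2 * h\<close> and \<open>u < 2 * (1 - h)\<close> add
      up to \<open>u < 1\<close>, so a negative power of \<open>u\<close> is at least 1.\<close>
    have "tec_edges W powr 0 \<le> tec_edges W powr - (4/25)" using b by (intro powr_mono') auto
    then show ?thesis using b by simp
  qed
  ultimately show ?thesis
    unfolding potential_def using mult_mono[of "exp (- 16)" "(tec_entropy W * (1 - tec_entropy W)) powr (4/5)" 1 "tec_edges W powr - (4/25)"] by simp
qed

text \<open>
  The potential alone only yields polynomially small entropies. Adding \<open>tec_log_weight\<close>, which decays merely
  like \<open>1 / ln (1 / h)\<close> and still contracts near \<open>h = 0\<close> and \<open>h = 1\<close>, gives doubly exponential smallness; away from
  the ends its growth is absorbed by the large multiple of the potential.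
\<close>
definition lyapunov :: "tec \<Rightarrow> real" where
  "lyapunov W = 100000 * exp 16 * potential W + tec_log_weight W"

text \<open>The rate 0.81801 exceeds the rate 0.818 of the potential by 1/100000. Multiplied by
  \<open>2 * 100000 * exp 16\<close>, this slack yields \<open>2 * exp 16 * potential W\<close>,
  which is at least 2 away from the ends and so dominates the log weights of both children.\<close>

lemma lyapunov_step:
  assumes "nondegenerate W"
  shows "lyapunov (tec_serial W) + lyapunov (tec_parallel W) \<le> 2 * (81801/100000) * lyapunov W"
proof -
  define E :: real where "E = exp 16"
  have E: "E > 0" by (simp add: E_def)
  note nn = nondegenerate_children[OF assms]
  have P: "E * (potential (tec_serial W) + potential (tec_parallel W)) \<le> E * (409/250 * potential W)"
    using E potential_step[OF assms] by (intro mult_left_mono) auto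
  have Pnn: "0 \<le> E * potential W" using E potential_nonneg by simp
  have "tec_log_weight (tec_serial W) + tec_log_weight (tec_parallel W) \<le> 2 * (81801/100000) * tec_log_weight W + 2 * (E * potential W)"
  proof (cases "tec_entropy W \<le> exp (- 10) \<or> 1 - tec_entropy W \<le> exp (- 10)")
    case True
    show ?thesis
      using tec_log_weight_step[OF assms True] tec_log_weight_bounds(1)[OF assms] Pnn by simp
  next
    case False
    then have "exp (- 16) \<le> potential W" using assms by (intro potential_ge) auto
    then have "E * exp (- 16) \<le> E * potential W" using E by (intro mult_left_mono) auto
    then have "1 \<le> E * potential W" by (simp add: E_def flip: exp_add)
    then show ?thesis
      using tec_log_weight_bounds[OF assms] tec_log_weight_bounds(2)[OF nn(1)] tec_log_weight_bounds(2)[OF nn(2)] by linarith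
  qed
  then show ?thesis using P unfolding lyapunov_def E_def[symmetric] by (simp add: algebra_simps)
qed


section \<open>From contraction to the scaling exponent\<close>

text \<open>The loss from converting the Lyapunov bound into a probability is only of order
  \<open>exp (n powr (1/3))\<close>, so an arbitrarily small exponential gain absorbs it.\<close>

lemma subexponential_bounded:
  fixes c K :: real
  assumes "c > 0"
  obtains B where "\<And>n::nat. (1 + (1 + exp (real n powr (1/3)) + real n) * K) * exp (- c * real n) \<le> B"
proof -
  have "(\<lambda>n::nat. (1 + exp (real n powr (1/3)) + real n) * exp (- c * real n)) \<longlonglongrightarrow> 0"
    using assms by real_asymp
  moreover have "(\<lambda>n::nat. exp (- c * real n)) \<longlonglongrightarrow> 0"
    using assms by real_asymp
  ultimately have "(\<lambda>n::nat. exp (- c * real n) + K * ((1 + exp (real n powr (1/3)) + real n) * exp (- c * real n))) \<longlonglongrightarrow> 0 + K * 0"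
    by (intro tendsto_intros)
  then have "convergent (\<lambda>n::nat. (1 + (1 + exp (real n powr (1/3)) + real n) * K) * exp (- c * real n))"
    unfolding convergent_def by (auto simp: algebra_simps)
  then have "Bseq (\<lambda>n::nat. (1 + (1 + exp (real n powr (1/3)) + real n) * K) * exp (- c * real n))"
    by (rule convergent_imp_Bseq)
  then obtain B where B: "\<forall>n::nat. norm ((1 + (1 + exp (real n powr (1/3)) + real n) * K) * exp (- c * real n)) \<le> B"
    by (rule BseqE)
  have "(1 + (1 + exp (real n powr (1/3)) + real n) * K) * exp (- c * real n) \<le> B" for n :: nat
    using spec[OF B, of n] unfolding real_norm_def by (rule abs_le_D1)
  then show thesis by (rule that)
qed

text \<open>Below \<theta> the indicator is 1; above \<open>1 - \<delta>\<close> the left side is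
  negative already without the last term; in between \<open>lyapunov w\<close> is at least
  \<open>1 / R\<close>. Taking means, with entropy a martingale, bounds the probability of small
  entropy from below.\<close>

lemma one_minus_of_bool_le:
  assumes "nondegenerate w" "0 < \<theta>" "\<theta> < 1" "0 < \<delta>" "\<delta> \<le> 1" "1 - ln \<theta> \<le> R" "1 - ln \<delta> \<le> R"
  shows "1 - \<delta> - tec_entropy w - R * lyapunov w \<le> of_bool (tec_entropy w < \<theta>)"
proof -
  note b = nondegenerate_bounds[OF assms(1)]
  have R: "R > 0" using assms ln_le_zero_iff[of \<delta>] by linarith
  have lw: "tec_log_weight w \<le> lyapunov w"
    using potential_nonneg[of w] by (simp add: lyapunov_def)
  have Rl: "0 \<le> R * lyapunov w" using R lw tec_log_weight_bounds[OF assms(1)] by (intro mult_nonneg_nonneg) auto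
  consider "tec_entropy w < \<theta>" | "tec_entropy w > 1 - \<delta>" | "\<theta> \<le> tec_entropy w" "\<delta> \<le> 1 - tec_entropy w" by linarith
  then show ?thesis
  proof cases
    case 3
    have "1 / R \<le> log_weight \<theta>" "1 / R \<le> log_weight \<delta>"
      using assms R
      by (auto simp: log_weight_def ln_less_one intro!: divide_left_mono mult_pos_pos)
    moreover have "log_weight \<theta> \<le> log_weight (tec_entropy w)" "log_weight \<delta> \<le> log_weight (1 - tec_entropy w)"
      using 3 assms b by (auto intro!: log_weight_mono)
    ultimately have "1 / R \<le> tec_log_weight w" unfolding tec_log_weight_def by simp
    then have "1 / R \<le> lyapunov w" using lw by simp
    then have "1 \<le> R * lyapunov w" using R by (simp add: pos_divide_le_eq mult.commute)
    then show ?thesis using assms b by (simp add: of_bool_def)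
  qed (use Rl assms b in \<open>auto simp: of_bool_def\<close>)
qed

text \<open>Both sides are compared after raising them to the power 245 = 5 * 7 * 7, with upward
  rounding between the stages to keep the fractions short. The exponent \<open>245/71\<close> is
  about 3.4507.\<close>

lemma scaling_rate: "81801/100000 < 2 powr (- 71/245 :: real)"
proof -
  have "((81801/100000 :: real) ^ 5) ^ 7 \<le> (45783/125000) ^ 7"
    by (intro power_mono) (simp_all add: power_divide)
  also have "\<dots> \<le> 44211/50000000" by (simp add: power_divide)
  finally have "(((81801/100000 :: real) ^ 5) ^ 7) ^ 7 \<le> (44211/50000000) ^ 7"
    by (intro power_mono) simp_all
  also have "\<dots> < 1 / 2 ^ 71" by (simp add: power_divide)
  also have "\<dots> = (2 powr (- 71/245)) ^ 245"
  proof -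
    have "(2 powr (- 71/245 :: real)) ^ 245 = 2 powr (- 71)" by (subst powr_power) simp_all
    then show ?thesis unfolding powr_minus_divide by simp
  qed
  finally have "(81801/100000 :: real) ^ 245 < (2 powr (- 71/245)) ^ 245"
    unfolding power_mult[symmetric] by (simp only: numeral_times_numeral num.simps arith_simps)
  then show ?thesis
    by (rule power_less_imp_less_base) simp
qed

theorem nondegenerate_scaling:
  assumes W: "nondegenerate W"
  shows "\<exists>C>0. \<forall>n::nat. process_prob W n (\<lambda>w. tec_entropy w < exp (- exp (real n powr (1/3))))
        \<ge> 1 - tec_entropy W - C * 2 powr (- real n / (245/71))"
proof -
  define lam rate :: real where "lam = 81801/100000" and "rate = 2 powr (- 71/245)"
  \<comment> \<open>The exponential gain of \<open>rate\<close> over \<open>lam\<close>, to be spent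
    on the subexponential factor.\<close>
  define c where "c = ln (rate / lam)"
  have lam: "0 < lam" "lam < 1" by (simp_all add: lam_def)
  have "lam < rate" using scaling_rate by (simp add: lam_def rate_def)
  then have c: "c > 0" using lam by (simp add: c_def)
  have lam_n: "lam ^ n = rate ^ n * exp (- c * real n)" for n
  proof -
    have "exp (- c) = lam / rate" using lam \<open>lam < rate\<close> by (simp add: c_def exp_minus)
    then have "lam = rate * exp (- c)" using lam \<open>lam < rate\<close> by simp
    then have "lam ^ n = rate ^ n * exp (- c) ^ n" by (metis power_mult_distrib)
    then show ?thesis by (simp add: exp_of_nat_mult[symmetric] mult.commute)
  qed
  obtain B where B: "(1 + (1 + exp (real n powr (1/3)) + real n) * lyapunov W) * exp (- c * real n) \<le> B" for n :: nat
    using subexponential_bounded[OF c] by blast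
  have bound: "process_prob W n (\<lambda>w. tec_entropy w < exp (- exp (real n powr (1/3))))
        \<ge> 1 - tec_entropy W - max B 1 * 2 powr (- real n / (245/71))" for n :: nat
  proof -
    define \<theta> where "\<theta> = exp (- exp (real n powr (1/3)))"
    \<comment> \<open>\<open>R\<close> dominates both \<open>1 - ln \<theta>\<close> and
      \<open>1 - ln (lam ^ n)\<close>; the cutoff near entropy 1 is \<delta> =
      \<open>lam ^ n\<close>, so it costs no more than the contraction itself.\<close>
    define R where "R = 1 + exp (real n powr (1/3)) + real n"
    have "- ln lam \<le> 1"
      using ln_le_minus_one[of "1 / lam"] by (simp add: ln_div lam_def)
    then have "- ln (lam ^ n) \<le> real n"
      using lam mult_left_mono[of "- ln lam" 1 "real n"] by (simp add: ln_realpow)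
    then have R: "1 - ln \<theta> \<le> R" "1 - ln (lam ^ n) \<le> R"
      using exp_gt_zero[of "real n powr (1/3)"] unfolding R_def \<theta>_def ln_exp by linarith+
    have R0: "R \<ge> 0" by (simp add: R_def)
    have "tec_mean n (\<lambda>w. (1 - lam ^ n) - tec_entropy w - R * lyapunov w) W
        \<le> process_prob W n (\<lambda>w. tec_entropy w < \<theta>)"
      unfolding process_prob_eq_mean
      using lam R by (intro tec_mean_mono one_minus_of_bool_le W) (auto simp: \<theta>_def power_le_one)
    moreover have "R * tec_mean n lyapunov W \<le> R * (lam ^ n * lyapunov W)"
      using W lyapunov_step R0 by (intro mult_left_mono tec_mean_le_power) (auto simp: lam_def)
    ultimately have "1 - tec_entropy W - (1 + R * lyapunov W) * lam ^ n \<le> process_prob W n (\<lambda>w. tec_entropy w < \<theta>)"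
      unfolding tec_mean_affine tec_mean_entropy[OF W] by (simp add: algebra_simps)
    moreover have "(1 + R * lyapunov W) * lam ^ n \<le> max B 1 * rate ^ n"
    proof -
      have "(1 + R * lyapunov W) * lam ^ n = rate ^ n * ((1 + R * lyapunov W) * exp (- c * real n))"
        by (simp add: lam_n)
      also have "\<dots> \<le> rate ^ n * max B 1"
        using B[of n] by (intro mult_left_mono) (auto simp: R_def rate_def)
      finally show ?thesis by (simp add: mult.commute)
    qed
    moreover have "rate ^ n = 2 powr (- real n / (245/71))"
      by (simp add: rate_def powr_realpow[symmetric] powr_powr mult.commute)
    ultimately show ?thesis by (simp add: \<theta>_def)
  qed
  \<comment> \<open>The maximum with 1 makes the constant positive.\<close>
  show ?thesis by (rule exI[of _ "max B 1"]) (use bound in auto)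
qed

theorem mainTheorem1:
  fixes W :: tec
  assumes "(\<exists>p q r s t. W = (p,q,r,s,t) \<and> is_tec W \<and> p*q*r*s*t > 0)
         \<or> (\<exists>\<delta> \<epsilon> :: real. 0 < \<delta> \<and> \<delta> < 1 \<and> 0 < \<epsilon> \<and> \<epsilon> < 1 \<and>
              W = ((1-\<delta>)*(1-\<epsilon>), (1-\<delta>)*\<epsilon>, 0, \<delta>*(1-\<epsilon>), \<delta>*\<epsilon>))"
  shows "\<exists>\<mu> C :: real. 0 < \<mu> \<and> \<mu> < 3.451 \<and> C > 0 \<and>
     (\<forall>n::nat. process_prob W n (\<lambda>w. tec_entropy w < exp (- exp (real n powr (1/3))))
        \<ge> 1 - tec_entropy W - C * 2 powr (- real n / \<mu>))"
proof -
  have "nondegenerate W"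
    using assms
  proof (elim disjE exE conjE)
    fix p q r s t assume W: "W = (p, q, r, s, t)" "is_tec W" and pos: "0 < p * q * r * s * t"
    then have "0 \<le> p" "0 \<le> q" "0 \<le> r" "0 \<le> s" "0 \<le> t" by (simp_all add: is_tec_def)
    moreover have "p \<noteq> 0" "q \<noteq> 0" "t \<noteq> 0" using pos by auto
    ultimately show ?thesis using W by simp
  next
    fix \<delta> \<epsilon> :: real
    assume "0 < \<delta>" "\<delta> < 1" "0 < \<epsilon>" "\<epsilon> < 1" "W = ((1-\<delta>)*(1-\<epsilon>), (1-\<delta>)*\<epsilon>, 0, \<delta>*(1-\<epsilon>), \<delta>*\<epsilon>)"
    then show ?thesis by (simp add: is_tec_def add_pos_pos) (simp add: algebra_simps)
  qed
  from nondegenerate_scaling[OF this] obtain C where "C > 0"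
    "\<forall>n::nat. process_prob W n (\<lambda>w. tec_entropy w < exp (- exp (real n powr (1/3))))
        \<ge> 1 - tec_entropy W - C * 2 powr (- real n / (245/71))"
    by blast
  then show ?thesis by (intro exI[of _ "245/71"] exI[of _ C]) simp
qed

end
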